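(* Let $X$ be a spectrally negative Lévy process with Lévy measure $\Pi$ which has a Gaussian component, i.e. whose Gaussian coefficient satisfies $\sigma>0$. Suppose its Blumenthal–Getoor index belongs to $[0,2)$, that is, $$\inf\Bigl\{\beta\ge 0:\int_{|x|<1}|x|^\beta\,\Pi(\mathrm dx)<\infty\Bigr\}\in[0,2).$$ Then for each $q\ge 0$ and each $n=0,1,2,\dots$, the $q$-scale function $W^{(q)}$, restricted to $(0,\infty)$, belongs to $C^{n+3}(0,\infty)$ if and only if $\overline{\Pi}\in C^n(0,\infty)$, where $\overline\Pi(x)=\Pi(-\infty,-x)$ for $x>0$.
   Context: A spectrally negative Lévy process $X=\{X_t:t\ge 0\}$ is a real-valued process, started from $0$ under the probability $P$, with almost surely right-continuous paths with left limits, stationary independent increments and no positive jumps; as usual it is assumed not to have monotone decreasing paths. Its Laplace exponent $\psi$ is defined by $E(e^{\theta X_t})=e^{t\psi(\theta)}$ and is finite for all $\theta\ge 0$, with $\psi(0+)=0$ and $\psi(\infty)=\infty$. It has the form $$\psi(\theta)=a\theta+\tfrac12\sigma^2\theta^2+\int_{(-\infty,0)}\bigl(e^{\theta x}-1-\theta x\mathbf 1_{(x>-1)}\bigr)\,\Pi(\mathrm dx),$$ where $a\in\mathbb R$, $\sigma\ge 0$ is the Gaussian coefficient, and $\Pi$ is the Lévy measure, a measure on $(-\infty,0)$ with $\int_{(-\infty,0)}(1\wedge x^2)\,\Pi(\mathrm dx)<\infty$. For $q\ge 0$, $\Phi(q)$ denotes the largest root in $[0,\infty)$ of $\psi(\theta)=q$.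 The $q$-scale function $W^{(q)}:\mathbb R\to[0,\infty)$ is the function with $W^{(q)}(x)=0$ for $x<0$, continuous on $[0,\infty)$, with $$\int_0^\infty e^{-\theta x}W^{(q)}(x)\,\mathrm dx=\frac{1}{\psi(\theta)-q}\qquad\text{for }\theta>\Phi(q).$$ $C^0(0,\infty)$ denotes the continuous functions on $(0,\infty)$. *)

theory Defs
  imports "HOL-Probability.Probability"
begin

(* Only the times t >= 0 of the process X matter. *)

locale levy_process = prob_space M for M :: "'a measure" +
  fixes X :: "real \<Rightarrow> 'a \<Rightarrow> real"
  assumes random_variable: "0 \<le> t \<Longrightarrow> random_variable borel (X t)"
    and start_zero: "AE \<omega> in M. X 0 \<omega> = 0"
    and right_continuous_paths: "AE \<omega> in M. \<forall>t\<ge>0. ((\<lambda>s. X s \<omega>) \<longlongrightarrow> X t \<omega>) (at_right t)"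
    and left_limits: "AE \<omega> in M. \<forall>t>0. \<exists>l. ((\<lambda>s. X s \<omega>) \<longlongrightarrow> l) (at_left t)"
    and stationary_increments:
      "0 \<le> s \<Longrightarrow> s \<le> t \<Longrightarrow>
         distr M borel (\<lambda>\<omega>. X t \<omega> - X s \<omega>) = distr M borel (X (t - s))"
    and independent_increments:
      "0 \<le> u 0 \<Longrightarrow> mono_on {..n} u \<Longrightarrow>
         indep_vars (\<lambda>_. borel) (\<lambda>i \<omega>. X (u (Suc i)) \<omega> - X (u i) \<omega>) {..<n::nat}"

locale spectrally_negative_levy_process = levy_process +
  assumes no_positive_jumps:
      "AE \<omega> in M. \<forall>t>0. \<forall>l. ((\<lambda>s. X s \<omega>) \<longlongrightarrow> l) (at_left t) \<longrightarrow> X t \<omega> \<le> l"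
    and not_decreasing: "\<not> (AE \<omega> in M. antimono_on {0..} (\<lambda>t. X t \<omega>))"

(* On [0,\<infinity>) this determines \<psi>; its values on negative arguments are irrelevant. *)
definition is_laplace_exponent ::
    "'a measure \<Rightarrow> (real \<Rightarrow> 'a \<Rightarrow> real) \<Rightarrow> (real \<Rightarrow> real) \<Rightarrow> bool" where
  "is_laplace_exponent M X \<psi> \<longleftrightarrow>
     (\<forall>\<theta>\<ge>0. \<forall>t\<ge>0. integrable M (\<lambda>\<omega>. exp (\<theta> * X t \<omega>)) \<and>
                 (\<integral>\<omega>. exp (\<theta> * X t \<omega>) \<partial>M) = exp (t * \<psi> \<theta>))"

(* A measure on the negative half-line is a Borel measure on the reals that
   gives no mass to [0,\<infinity>). *)
definition negative_levy_measure :: "real measure \<Rightarrow> bool" where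
  "negative_levy_measure \<nu> \<longleftrightarrow>
     sets \<nu> = sets borel \<and> emeasure \<nu> {0::real..} = 0 \<and>
     (\<integral>\<^sup>+x\<in>{..<0}. ennreal (min 1 (x\<^sup>2)) \<partial>\<nu>) < \<infinity>"

definition levy_khintchine_exponent ::
    "real \<Rightarrow> real \<Rightarrow> real measure \<Rightarrow> real \<Rightarrow> real" where
  "levy_khintchine_exponent a \<sigma> \<nu> \<theta> =
     a * \<theta> + 1/2 * \<sigma>\<^sup>2 * \<theta>\<^sup>2 +
     (LINT x:{..<0}|\<nu>. exp (\<theta> * x) - 1 - \<theta> * x * indicator {-1<..} x)"

(* (a, \<sigma>, \<nu>) are the drift, Gaussian coefficient and Levy measure of the process
   whose Laplace exponent is \<psi>; they are uniquely determined by \<psi> on [0,\<infinity>). *)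
definition is_levy_triplet ::
    "(real \<Rightarrow> real) \<Rightarrow> real \<Rightarrow> real \<Rightarrow> real measure \<Rightarrow> bool" where
  "is_levy_triplet \<psi> a \<sigma> \<nu> \<longleftrightarrow>
     0 \<le> \<sigma> \<and> negative_levy_measure \<nu> \<and>
     (\<forall>\<theta>\<ge>0. \<psi> \<theta> = levy_khintchine_exponent a \<sigma> \<nu> \<theta>)"

definition largest_root :: "(real \<Rightarrow> real) \<Rightarrow> real \<Rightarrow> real" where
  "largest_root \<psi> q = (GREATEST \<theta>. 0 \<le> \<theta> \<and> \<psi> \<theta> = q)"

definition is_scale_function ::
    "(real \<Rightarrow> real) \<Rightarrow> real \<Rightarrow> (real \<Rightarrow> real) \<Rightarrow> bool" where
  "is_scale_function \<psi> q W \<longleftrightarrow>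
     (\<forall>x. 0 \<le> W x) \<and> (\<forall>x<0. W x = 0) \<and> continuous_on {0..} W \<and>
     (\<forall>\<theta>>largest_root \<psi> q.
        set_integrable lborel {0..} (\<lambda>x. exp (- \<theta> * x) * W x) \<and>
        (LBINT x:{0..}. exp (- \<theta> * x) * W x) = 1 / (\<psi> \<theta> - q))"

definition blumenthal_getoor_index :: "real measure \<Rightarrow> real" where
  "blumenthal_getoor_index \<nu> =
     Inf {\<beta>. 0 \<le> \<beta> \<and> (\<integral>\<^sup>+x\<in>{x. \<bar>x\<bar> < 1}. ennreal (\<bar>x\<bar> powr \<beta>) \<partial>\<nu>) < \<infinity>}"

definition levy_tail :: "real measure \<Rightarrow> real \<Rightarrow> real" where
  "levy_tail \<nu> x = measure \<nu> {..< -x}"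

(* n times continuously differentiable; meant for open sets S *)
fun C_on :: "nat \<Rightarrow> real set \<Rightarrow> (real \<Rightarrow> real) \<Rightarrow> bool" where
  "C_on 0 S f \<longleftrightarrow> continuous_on S f"
| "C_on (Suc n) S f \<longleftrightarrow>
     (\<exists>f'. (\<forall>x\<in>S. (f has_real_derivative f' x) (at x)) \<and> C_on n S f')"

end

theory Submission
  imports Defs
begin

text \<open>
Write \<open>*\<close> for convolution on the half-line, \<open>H\<close> for the Heaviside function, \<open>J = H * H\<close> for the identity on
the half-line and \<open>s = \<sigma>\<^sup>2 / 2\<close>. Let \<open>K\<close> be the double tail, whose derivative is minus the tail of the Levy measure.
Integrating the Levy-Khintchine formula by parts twice shows that \<open>\<psi> \<theta> = a \<theta> + s \<theta>\<^sup>2 + \<theta>\<^sup>2 L K(\<theta>)\<close>, where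
\<open>L\<close> is the Laplace transform. Hence \<open>L W = 1 / (\<psi> - q)\<close> means that \<open>s W + k * W = J\<close> with \<open>k = K + a H - q J\<close>
(\<open>scale_function_volterra\<close>). This is a Volterra equation of the second kind because \<open>s > 0\<close>; with \<open>h = k / s\<close> and
\<open>w = s W\<close> it reads \<open>w + h * w = J\<close>.

Let \<open>\<delta>\<close> be the unit of convolution. The inverse of \<open>\<delta> + h\<close> has the form \<open>\<delta> + r\<close>, where \<open>r + h + h * r = 0\<close>, and
\<open>w = J + J * r\<close>, so \<open>r\<close> is the second derivative of \<open>w\<close> (\<open>obtain_resolvent\<close>). The tail is \<open>n\<close> times continuously
differentiable iff \<open>h\<close> is so \<open>n + 1\<close> times (\<open>C_on_double_tail_iff\<close>), and \<open>W\<close> is so \<open>n + 3\<close> times iff \<open>r\<close> is so \<open>n + 1\<close> times.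
It remains to see that \<open>h\<close> and \<open>r\<close> have the same smoothness on the open half-line. Their
relation is symmetric, so it suffices to pass from one to the other.

For this, expand \<open>r = - h + h * h - \<dots>\<close> up to a remainder that contains a high convolution power of \<open>h\<close>. Convolutions of
functions that are smooth away from 0 are smooth away from 0, however their derivatives behave at 0 (\<open>C_on_conv\<close>).
The remainder is smooth because some power of \<open>h\<close> is an \<open>M\<close>-fold integral, for each \<open>M\<close>
(\<open>eventually_smoothingI\<close>). Here the hypothesis on the index is used: \<open>K y\<close> and \<open>y\<close> times the tail at \<open>y\<close> are
of order \<open>y\<^sup>1\<^sup>-\<^sup>\<beta>\<close> with \<open>\<beta> < 2\<close>, so \<open>h\<close> and the derivative of \<open>y h\<close> are less singular than \<open>1 / y\<close> by a fixed power, and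
every convolution with \<open>h\<close> gains this power. That \<open>r\<close> has powers of the same kind is automatic, because
\<open>r = - h * (\<delta> + r)\<close> makes the powers of \<open>h\<close> factors of the powers of \<open>r\<close> (\<open>eventually_smoothing_resolvent\<close>).
\<close>

section \<open>Convolution of functions on the half-line\<close>

definition power_kernel :: "real \<Rightarrow> real \<Rightarrow> real" where
  "power_kernel a x = indicator {0<..} x * x powr (a - 1)"

text \<open>Functions on the half-line \<open>(0, \<infinity>)\<close> are represented by functions on the real line that vanish on
\<open>(-\<infinity>, 0]\<close>; then convolution on the half-line is an integral over the whole line, and identities
between convolutions are identities between functions, without side conditions on the argument.
For \<open>a > 0\<close> the bound keeps every convolution integral absolutely convergent at \<^emph>\<open>every\<close> point,
so no null sets have to be tracked.\<close>

definition power_dominated :: "real \<Rightarrow> (real \<Rightarrow> real) \<Rightarrow> bool" where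
  "power_dominated a f \<longleftrightarrow> f \<in> borel_measurable borel \<and> (\<forall>x\<le>0. f x = 0) \<and>
     (\<forall>T>0. \<exists>C\<ge>0. \<forall>x\<le>T. \<bar>f x\<bar> \<le> C * power_kernel a x)"

definition conv :: "(real \<Rightarrow> real) \<Rightarrow> (real \<Rightarrow> real) \<Rightarrow> real \<Rightarrow> real" where
  "conv f g x = (\<integral>y. f (x - y) * g y \<partial>lborel)"

lemma power_kernel_measurable [measurable]: "power_kernel a \<in> borel_measurable borel"
  unfolding power_kernel_def[abs_def] by measurable

lemma power_kernel_nonneg [simp]: "0 \<le> power_kernel a x"
  by (simp add: power_kernel_def)

lemma power_kernel_nonpos [simp]: "x \<le> 0 \<Longrightarrow> power_kernel a x = 0"
  by (simp add: power_kernel_def)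

lemma power_kernel_pos: "0 < x \<Longrightarrow> power_kernel a x = x powr (a - 1)"
  by (simp add: power_kernel_def)

lemma power_kernel_scale:
  assumes "0 < c" shows "power_kernel a (c * x) = c powr (a - 1) * power_kernel a x"
  using assms by (cases "0 < x") (auto simp: power_kernel_pos powr_mult mult_le_0_iff)

text \<open>The scaling \<open>y = x t\<close> reduces the integral to the Beta integral. The exponents add up, so repeated
convolution makes a singularity at the origin weaker and finally removes it.\<close>

lemma power_kernel_conv:
  assumes "0 < a" "0 < b"
  shows "has_bochner_integral lborel (\<lambda>y. power_kernel a (x - y) * power_kernel b y)
           (Beta b a * power_kernel (a + b) x)"
proof (cases "0 < x")
  case False
  then have "(\<lambda>y. power_kernel a (x - y) * power_kernel b y) = (\<lambda>y. 0)"
    by (auto simp: fun_eq_iff power_kernel_def indicator_def)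
  then show ?thesis using False by (simp add: has_bochner_integral_zero)
next
  case True
  let ?f = "\<lambda>y. power_kernel a (x - y) * power_kernel b y"
  have scale: "?f (0 + x * t)
      = x powr (a + b - 2) * (indicator {0..1} t *\<^sub>R (t powr (b - 1) * (1 - t) powr (a - 1)))" for t
  proof -
    have "?f (0 + x * t) = power_kernel a (x * (1 - t)) * power_kernel b (x * t)"
      by (simp add: algebra_simps)
    also have "\<dots> = x powr (a - 1) * x powr (b - 1) * (power_kernel a (1 - t) * power_kernel b t)"
      unfolding power_kernel_scale[OF True] by simp
    also have "power_kernel a (1 - t) * power_kernel b t
        = indicator {0..1} t *\<^sub>R (t powr (b - 1) * (1 - t) powr (a - 1))"
      by (auto simp: power_kernel_def indicator_def)
    finally show ?thesis by (simp add: powr_add [symmetric] algebra_simps)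
  qed
  note ib = integrable_Beta[OF assms(2,1)]
  have "integrable lborel (\<lambda>t. ?f (0 + x * t))"
    unfolding scale using ib by (simp add: set_integrable_def)
  then have int: "integrable lborel ?f"
    using lborel_integrable_real_affine_iff[of x ?f 0] True by simp
  have "(\<integral>t. indicator {0..1} t *\<^sub>R (t powr (b - 1) * (1 - t) powr (a - 1)) \<partial>lborel) = Beta b a"
    using set_borel_integral_eq_integral(2)[OF ib]
      integral_unique[OF has_integral_Beta_real[OF assms(2,1)]]
    by (simp add: set_lebesgue_integral_def)
  then have "(\<integral>t. ?f (0 + x * t) \<partial>lborel) = x powr (a + b - 2) * Beta b a"
    unfolding scale by simp
  moreover have "(\<integral>y. ?f y \<partial>lborel) = \<bar>x\<bar> *\<^sub>R (\<integral>t. ?f (0 + x * t) \<partial>lborel)"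
    using True by (intro lborel_integral_real_affine) simp
  ultimately have "(\<integral>y. ?f y \<partial>lborel) = x powr 1 * x powr (a + b - 2) * Beta b a"
    using True by simp
  also have "x powr 1 * x powr (a + b - 2) = power_kernel (a + b) x"
    unfolding powr_add [symmetric] using True by (simp add: power_kernel_pos)
  also have "power_kernel (a + b) x * Beta b a = Beta b a * power_kernel (a + b) x"
    by simp
  finally show ?thesis using int by (simp add: has_bochner_integral_iff)
qed

lemma power_kernel_weaken:
  assumes "a \<le> b" "x \<le> T" "0 < T"
  shows "power_kernel b x \<le> T powr (b - a) * power_kernel a x"
proof (cases "0 < x")
  case True
  have "x powr (b - 1) = x powr (b - a) * x powr (a - 1)"
    by (simp add: powr_add [symmetric])
  also have "\<dots> \<le> T powr (b - a) * x powr (a - 1)"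
    using assms True by (intro mult_right_mono powr_mono2) auto
  finally show ?thesis using True by (simp add: power_kernel_pos)
qed simp

lemma power_dominated_measurable [measurable_dest]:
  "power_dominated a f \<Longrightarrow> f \<in> borel_measurable borel"
  by (simp add: power_dominated_def)

lemma power_dominated_nonpos: "power_dominated a f \<Longrightarrow> x \<le> 0 \<Longrightarrow> f x = 0"
  by (simp add: power_dominated_def)

lemma power_dominated_bound:
  assumes "power_dominated a f"
  obtains C where "0 \<le> C" "\<And>x. x \<le> T \<Longrightarrow> \<bar>f x\<bar> \<le> C * power_kernel a x"
proof -
  have "0 < max T 1" by simp
  then show ?thesis
    using assms that unfolding power_dominated_def by (metis max.coboundedI1)
qed

lemma power_dominatedI:
  assumes "f \<in> borel_measurable borel" "\<And>x. x \<le> 0 \<Longrightarrow> f x = 0"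
    and "\<And>T. 0 < T \<Longrightarrow> \<exists>C. \<forall>x. 0 < x \<and> x \<le> T \<longrightarrow> \<bar>f x\<bar> \<le> C * power_kernel a x"
  shows "power_dominated a f"
  unfolding power_dominated_def
proof (intro conjI allI impI)
  fix T :: real assume "0 < T"
  from assms(3)[OF this] obtain C where C: "\<And>x. 0 < x \<Longrightarrow> x \<le> T \<Longrightarrow> \<bar>f x\<bar> \<le> C * power_kernel a x"
    by blast
  have "\<bar>f x\<bar> \<le> max C 0 * power_kernel a x" if "x \<le> T" for x
  proof (cases "0 < x")
    case True
    have "C * power_kernel a x \<le> max C 0 * power_kernel a x" by (intro mult_right_mono) auto
    then show ?thesis using C[OF True that] by linarith
  qed (use assms(2) in simp)
  then show "\<exists>C\<ge>0. \<forall>x\<le>T. \<bar>f x\<bar> \<le> C * power_kernel a x"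
    by (intro exI[of _ "max C 0"]) auto
qed (use assms in auto)

lemma power_dominated_weaken:
  assumes f: "power_dominated b f" and "a \<le> b"
  shows "power_dominated a f"
proof (rule power_dominatedI)
  fix T :: real assume T: "0 < T"
  obtain C where C: "0 \<le> C" "\<And>x. x \<le> T \<Longrightarrow> \<bar>f x\<bar> \<le> C * power_kernel b x"
    using power_dominated_bound[OF f] by blast
  have "\<bar>f x\<bar> \<le> C * T powr (b - a) * power_kernel a x" if "x \<le> T" for x
    using C(2)[OF that] mult_left_mono[OF power_kernel_weaken[OF assms(2) that T] C(1)]
    by (simp add: mult.assoc)
  then show "\<exists>C. \<forall>x. 0 < x \<and> x \<le> T \<longrightarrow> \<bar>f x\<bar> \<le> C * power_kernel a x" by blast
qed (use f in \<open>auto simp: power_dominated_def\<close>)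

lemma power_dominated_add:
  assumes f: "power_dominated a f" and g: "power_dominated a g"
  shows "power_dominated a (\<lambda>x. f x + g x)"
proof (rule power_dominatedI)
  fix T :: real assume T: "0 < T"
  obtain C where C: "\<And>x. x \<le> T \<Longrightarrow> \<bar>f x\<bar> \<le> C * power_kernel a x"
    using power_dominated_bound[OF f] by blast
  obtain D where D: "\<And>x. x \<le> T \<Longrightarrow> \<bar>g x\<bar> \<le> D * power_kernel a x"
    using power_dominated_bound[OF g] by blast
  have "\<bar>f x + g x\<bar> \<le> (C + D) * power_kernel a x" if "x \<le> T" for x
    using C[OF that] D[OF that] by (simp add: algebra_simps)
  then show "\<exists>C. \<forall>x. 0 < x \<and> x \<le> T \<longrightarrow> \<bar>f x + g x\<bar> \<le> C * power_kernel a x" by blast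
qed (use f g in \<open>auto simp: power_dominated_def\<close>)

lemma power_dominated_cmult:
  assumes f: "power_dominated a f"
  shows "power_dominated a (\<lambda>x. c * f x)"
proof (rule power_dominatedI)
  fix T :: real assume T: "0 < T"
  obtain C where C: "\<And>x. x \<le> T \<Longrightarrow> \<bar>f x\<bar> \<le> C * power_kernel a x"
    using power_dominated_bound[OF f] by blast
  have "\<bar>c * f x\<bar> \<le> (\<bar>c\<bar> * C) * power_kernel a x" if "x \<le> T" for x
    using mult_left_mono[OF C[OF that], of "\<bar>c\<bar>"] by (simp add: abs_mult mult.assoc)
  then show "\<exists>C. \<forall>x. 0 < x \<and> x \<le> T \<longrightarrow> \<bar>c * f x\<bar> \<le> C * power_kernel a x" by blast
qed (use f in \<open>auto simp: power_dominated_def\<close>)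

lemma power_dominated_abs:
  "power_dominated a f \<Longrightarrow> power_dominated a (\<lambda>x. \<bar>f x\<bar>)"
  by (auto simp: power_dominated_def)

lemma power_dominated_zero: "power_dominated a (\<lambda>x. 0)"
  by (auto simp: power_dominated_def intro!: exI[of _ 0])

lemma conv_kernel_bound:
  assumes f: "power_dominated a f" and g: "power_dominated b g"
  obtains C where "0 \<le> C" "\<And>x y. x \<le> T \<Longrightarrow>
     \<bar>f (x - y) * g y\<bar> \<le> C * (power_kernel a (x - y) * power_kernel b y)"
proof -
  obtain C where C: "0 \<le> C" "\<And>x. x \<le> T \<Longrightarrow> \<bar>f x\<bar> \<le> C * power_kernel a x"
    using power_dominated_bound[OF f] by blast
  obtain D where D: "0 \<le> D" "\<And>x. x \<le> T \<Longrightarrow> \<bar>g x\<bar> \<le> D * power_kernel b x"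
    using power_dominated_bound[OF g] by blast
  have "\<bar>f (x - y) * g y\<bar> \<le> (C * D) * (power_kernel a (x - y) * power_kernel b y)"
    if "x \<le> T" for x y
  proof (cases "0 < y \<and> y < x")
    case True
    then have "\<bar>f (x - y)\<bar> * \<bar>g y\<bar> \<le> (C * power_kernel a (x - y)) * (D * power_kernel b y)"
      using C(1) that by (intro mult_mono C(2) D(2)) auto
    then show ?thesis by (simp add: abs_mult mult_ac)
  next
    case False
    then show ?thesis
      using power_dominated_nonpos[OF f, of "x - y"] power_dominated_nonpos[OF g, of y]
        C(1) D(1) by (cases "y \<le> 0") auto
  qed
  then show ?thesis using that[of "C * D"] C(1) D(1) by auto
qed

lemma conv_integrable:
  assumes f: "power_dominated a f" and g: "power_dominated b g" and "0 < a" "0 < b"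
  shows "integrable lborel (\<lambda>y. f (x - y) * g y)"
proof -
  note [measurable] = power_dominated_measurable[OF f] power_dominated_measurable[OF g]
  obtain C where C: "\<And>x' y. x' \<le> x \<Longrightarrow>
     \<bar>f (x' - y) * g y\<bar> \<le> C * (power_kernel a (x' - y) * power_kernel b y)"
    using conv_kernel_bound[OF f g] by blast
  have "integrable lborel (\<lambda>y. C * (power_kernel a (x - y) * power_kernel b y))"
    using power_kernel_conv[OF assms(3,4), of x] by (auto simp: has_bochner_integral_iff)
  then show ?thesis
    by (rule Bochner_Integration.integrable_bound) (use C in \<open>auto intro!: AE_I2 order_trans[OF C]\<close>)
qed

lemma conv_measurable:
  assumes [measurable]: "f \<in> borel_measurable borel" "g \<in> borel_measurable borel"
  shows "conv f g \<in> borel_measurable borel"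
  unfolding conv_def[abs_def] by measurable

lemma power_dominated_conv:
  assumes f: "power_dominated a f" and g: "power_dominated b g" and ab: "0 < a" "0 < b"
  shows "power_dominated (a + b) (conv f g)"
proof (rule power_dominatedI)
  show "conv f g \<in> borel_measurable borel"
    by (intro conv_measurable power_dominated_measurable[OF f] power_dominated_measurable[OF g])
next
  fix x :: real assume "x \<le> 0"
  then have eq: "f (x - y) * g y = 0" for y
    using power_dominated_nonpos[OF f, of "x - y"] power_dominated_nonpos[OF g, of y]
    by (cases "y \<le> 0") auto
  show "conv f g x = 0" unfolding conv_def eq by simp
next
  fix T :: real assume "0 < T"
  obtain C where C: "0 \<le> C" "\<And>x y. x \<le> T \<Longrightarrow>
     \<bar>f (x - y) * g y\<bar> \<le> C * (power_kernel a (x - y) * power_kernel b y)"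
    using conv_kernel_bound[OF f g] by blast
  have "\<bar>conv f g x\<bar> \<le> C * Beta b a * power_kernel (a + b) x" if "x \<le> T" for x
  proof -
    have K: "has_bochner_integral lborel (\<lambda>y. C * (power_kernel a (x - y) * power_kernel b y))
        (C * (Beta b a * power_kernel (a + b) x))"
      using power_kernel_conv[OF ab, of x] by (rule has_bochner_integral_mult_right)
    have "\<bar>conv f g x\<bar> \<le> (\<integral>y. \<bar>f (x - y) * g y\<bar> \<partial>lborel)"
      unfolding conv_def using integral_norm_bound[of lborel "\<lambda>y. f (x - y) * g y"] by simp
    also have "\<dots> \<le> (\<integral>y. C * (power_kernel a (x - y) * power_kernel b y) \<partial>lborel)"
      using conv_integrable[OF f g ab] K C(2)[OF that]
      by (intro integral_mono) (auto simp: has_bochner_integral_iff)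
    also have "\<dots> = C * Beta b a * power_kernel (a + b) x"
      using K by (simp add: has_bochner_integral_iff)
    finally show ?thesis .
  qed
  then show "\<exists>C. \<forall>x. 0 < x \<and> x \<le> T \<longrightarrow> \<bar>conv f g x\<bar> \<le> C * power_kernel (a + b) x" by blast
qed

text \<open>The algebra, under addition and convolution, in which the integral equation of the scale function is
solved. The exponent may differ from function to function.\<close>

definition volterra :: "(real \<Rightarrow> real) \<Rightarrow> bool" where
  "volterra f \<longleftrightarrow> (\<exists>a>0. power_dominated a f)"

lemma volterraI: "power_dominated a f \<Longrightarrow> 0 < a \<Longrightarrow> volterra f"
  by (auto simp: volterra_def)

lemma volterra_measurable [measurable_dest]: "volterra f \<Longrightarrow> f \<in> borel_measurable borel"
  using power_dominated_measurable by (auto simp: volterra_def)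

lemma volterra_nonpos: "volterra f \<Longrightarrow> x \<le> 0 \<Longrightarrow> f x = 0"
  using power_dominated_nonpos by (auto simp: volterra_def)

lemma volterra_conv: "volterra f \<Longrightarrow> volterra g \<Longrightarrow> volterra (conv f g)"
  unfolding volterra_def by (meson power_dominated_conv add_pos_pos)

lemma volterra_add:
  assumes "volterra f" "volterra g" shows "volterra (\<lambda>x. f x + g x)"
proof -
  obtain a b where "a > 0" "b > 0" "power_dominated a f" "power_dominated b g"
    using assms by (auto simp: volterra_def)
  then show ?thesis unfolding volterra_def
    by (intro exI[of _ "min a b"] conjI power_dominated_add) (auto intro: power_dominated_weaken)
qed

lemma volterra_cmult: "volterra f \<Longrightarrow> volterra (\<lambda>x. c * f x)"
  unfolding volterra_def using power_dominated_cmult by blast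

lemma volterra_uminus: "volterra f \<Longrightarrow> volterra (\<lambda>x. - f x)"
  using volterra_cmult[of f "-1"] by simp

lemma volterra_zero: "volterra (\<lambda>x. 0)"
  unfolding volterra_def using power_dominated_zero zero_less_one by blast

lemma volterra_abs: "volterra f \<Longrightarrow> volterra (\<lambda>x. \<bar>f x\<bar>)"
  unfolding volterra_def using power_dominated_abs by blast

lemma volterra_conv_integrable:
  "volterra f \<Longrightarrow> volterra g \<Longrightarrow> integrable lborel (\<lambda>y. f (x - y) * g y)"
  by (auto simp: volterra_def conv_integrable)

lemma conv_commute: "conv f g = conv g f"
proof
  fix x
  have "(\<integral>y. f (x - y) * g y \<partial>lborel) = \<bar>-1\<bar> *\<^sub>R (\<integral>y. f (x - (x + (-1) * y)) * g (x + (-1) * y) \<partial>lborel)"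
    by (rule lborel_integral_real_affine) simp
  then show "conv f g x = conv g f x" by (simp add: conv_def mult.commute)
qed

lemma conv_add_left:
  assumes "volterra f" "volterra g" "volterra h"
  shows "conv (\<lambda>x. f x + g x) h = (\<lambda>x. conv f h x + conv g h x)"
  unfolding conv_def fun_eq_iff using assms
  by (auto simp: distrib_right intro!: Bochner_Integration.integral_add volterra_conv_integrable)

lemma conv_cmult_left: "conv (\<lambda>x. c * f x) h = (\<lambda>x. c * conv f h x)"
  unfolding conv_def fun_eq_iff by (simp add: mult.assoc)

lemma conv_add_right:
  assumes "volterra f" "volterra g" "volterra h"
  shows "conv h (\<lambda>x. f x + g x) = (\<lambda>x. conv h f x + conv h g x)"
  using conv_add_left[OF assms] by (simp add: conv_commute[of h])

lemma conv_cmult_right: "conv h (\<lambda>x. c * f x) = (\<lambda>x. c * conv h f x)"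
  using conv_cmult_left[of c f h] by (simp add: conv_commute[of h])

text \<open>By Fubini, for each \<open>x\<close> separately: the iterated integral of the absolute values is a value of
\<open>(|f| * |g|) * |h|\<close>, which is finite everywhere.\<close>

lemma conv_assoc:
  assumes f: "volterra f" and g: "volterra g" and h: "volterra h"
  shows "conv (conv f g) h = conv f (conv g h)"
proof
  fix x
  note [measurable] = volterra_measurable[OF f] volterra_measurable[OF g] volterra_measurable[OF h]
  define F where "F = (\<lambda>(z, y). f (x - y) * g (y - z) * h z)"
  have shift: "(\<integral>y. u (x - y) * v (y - z) \<partial>lborel) = conv u v (x - z)" for u v :: "real \<Rightarrow> real" and z
    using lborel_integral_real_affine[of 1 "\<lambda>y. u (x - y) * v (y - z)" z]
    by (simp add: conv_def algebra_simps)
  have int_y: "integrable lborel (\<lambda>y. f (x - y) * g (y - z) * h z)" for z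
    using lborel_integrable_real_affine[OF volterra_conv_integrable[OF f g, of "x - z"], of 1 "-z"]
    by (intro integrable_mult_left) (simp add: algebra_simps)
  have "integrable (lborel \<Otimes>\<^sub>M lborel) F"
  proof (rule lborel_pair.Fubini_integrable)
    show "F \<in> borel_measurable (lborel \<Otimes>\<^sub>M lborel)" unfolding F_def by measurable
    have "(\<integral>y. norm (F (z, y)) \<partial>lborel) = conv (\<lambda>x. \<bar>f x\<bar>) (\<lambda>x. \<bar>g x\<bar>) (x - z) * \<bar>h z\<bar>" for z
      unfolding F_def using shift[of "\<lambda>x. \<bar>f x\<bar>" "\<lambda>x. \<bar>g x\<bar>" z] by (simp add: abs_mult)
    then show "integrable lborel (\<lambda>z. \<integral>y. norm (F (z, y)) \<partial>lborel)"
      using volterra_conv_integrable[OF volterra_conv[OF volterra_abs[OF f] volterra_abs[OF g]]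
          volterra_abs[OF h]] by simp
    show "AE z in lborel. integrable lborel (\<lambda>y. F (z, y))"
      using int_y by (simp add: F_def)
  qed
  then have "(\<integral>y. (\<integral>z. f (x - y) * g (y - z) * h z \<partial>lborel) \<partial>lborel)
      = (\<integral>z. (\<integral>y. f (x - y) * g (y - z) * h z \<partial>lborel) \<partial>lborel)"
    unfolding F_def by (rule lborel_pair.Fubini_integral)
  moreover have "(\<integral>z. (\<integral>y. f (x - y) * g (y - z) * h z \<partial>lborel) \<partial>lborel) = conv (conv f g) h x"
    unfolding conv_def[of "conv f g"] using shift[of f g] by simp
  moreover have "(\<integral>y. (\<integral>z. f (x - y) * g (y - z) * h z \<partial>lborel) \<partial>lborel) = conv f (conv g h) x"
    unfolding conv_def[of f] conv_def[of g] by (simp add: mult.assoc)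
  ultimately show "conv (conv f g) h x = conv f (conv g h) x" by simp
qed

lemma conv_left_commute:
  assumes "volterra f" "volterra g" "volterra h"
  shows "conv f (conv g h) = conv g (conv f h)"
  using conv_assoc[of f g h] conv_assoc[of g f h] conv_commute[of f g] assms by simp

lemma power_dominated_times_id:
  assumes f: "power_dominated a f"
  shows "power_dominated (a + 1) (\<lambda>x. x * f x)"
proof (rule power_dominatedI)
  show "(\<lambda>x. x * f x) \<in> borel_measurable borel" using power_dominated_measurable[OF f] by measurable
next
  fix T :: real assume "0 < T"
  obtain C where C: "\<And>x. x \<le> T \<Longrightarrow> \<bar>f x\<bar> \<le> C * power_kernel a x"
    using power_dominated_bound[OF f] by blast
  have "\<bar>x * f x\<bar> \<le> C * power_kernel (a + 1) x" if "0 < x" "x \<le> T" for x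
  proof -
    have "\<bar>x * f x\<bar> \<le> x * (C * power_kernel a x)"
      using that C[OF that(2)] by (simp add: abs_mult)
    also have "\<dots> = C * power_kernel (a + 1) x"
      using that powr_add[of x 1 "a - 1"] by (simp add: power_kernel_pos)
    finally show ?thesis .
  qed
  then show "\<exists>C. \<forall>x. 0 < x \<and> x \<le> T \<longrightarrow> \<bar>x * f x\<bar> \<le> C * power_kernel (a + 1) x" by blast
qed (use f in \<open>simp add: power_dominated_def\<close>)

lemma volterra_times_id: "volterra f \<Longrightarrow> volterra (\<lambda>x. x * f x)"
  unfolding volterra_def using power_dominated_times_id by (metis add_pos_pos zero_less_one)

text \<open>Multiplication by the identity is a derivation of the convolution algebra, because
\<open>x = (x - y) + y\<close>.\<close>

lemma conv_times_id:
  assumes f: "volterra f" and g: "volterra g"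
  shows "x * conv f g x = conv (\<lambda>x. x * f x) g x + conv f (\<lambda>x. x * g x) x"
proof -
  have "conv (\<lambda>x. x * f x) g x + conv f (\<lambda>x. x * g x) x
      = (\<integral>y. (x - y) * f (x - y) * g y + f (x - y) * (y * g y) \<partial>lborel)"
    unfolding conv_def
    using volterra_conv_integrable[OF volterra_times_id[OF f] g, of x]
      volterra_conv_integrable[OF f volterra_times_id[OF g], of x]
    by (intro Bochner_Integration.integral_add[symmetric]) auto
  also have "\<dots> = (\<integral>y. x * (f (x - y) * g y) \<partial>lborel)"
    by (intro Bochner_Integration.integral_cong) (auto simp: algebra_simps)
  finally show ?thesis by (simp add: conv_def)
qed

section \<open>Smoothness and integration\<close>

lemma C_on_subset: "C_on n S f \<Longrightarrow> T \<subseteq> S \<Longrightarrow> C_on n T f"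
proof (induction n arbitrary: f)
  case 0 then show ?case by (simp add: continuous_on_subset)
next
  case (Suc n)
  then obtain f' where "\<forall>x\<in>S. (f has_real_derivative f' x) (at x)" "C_on n S f'" by auto
  then show ?case using Suc.IH[of f'] Suc.prems(2) by auto
qed

lemma C_on_cong:
  assumes "open S" "\<And>x. x \<in> S \<Longrightarrow> f x = g x" "C_on n S f"
  shows "C_on n S g"
proof (cases n)
  case 0 then show ?thesis using assms by (auto cong: continuous_on_cong)
next
  case (Suc k)
  then obtain f' where f': "\<And>x. x \<in> S \<Longrightarrow> (f has_real_derivative f' x) (at x)" "C_on k S f'"
    using assms(3) by auto
  have "(g has_real_derivative f' x) (at x)" if "x \<in> S" for x
    using has_field_derivative_transform_within_open[OF f'(1)[OF that] assms(1) that] assms(2) by auto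
  then show ?thesis using Suc f'(2) by auto
qed

lemma C_on_Suc_iff:
  assumes "open S" "\<And>x. x \<in> S \<Longrightarrow> (f has_real_derivative f' x) (at x)"
  shows "C_on (Suc n) S f \<longleftrightarrow> C_on n S f'"
proof
  assume "C_on (Suc n) S f"
  then obtain g where g: "\<And>x. x \<in> S \<Longrightarrow> (f has_real_derivative g x) (at x)" "C_on n S g"
    by auto
  have "g x = f' x" if "x \<in> S" for x
    using DERIV_unique[OF g(1)[OF that] assms(2)[OF that]] .
  then show "C_on n S f'" using C_on_cong[OF assms(1)] g(2) by blast
qed (use assms(2) in auto)

lemma C_on_imp_continuous_on: "C_on n S f \<Longrightarrow> continuous_on S f"
  by (cases n) (auto intro!: continuous_at_imp_continuous_on intro: DERIV_isCont)

lemma C_on_SucD: "C_on (Suc n) S f \<Longrightarrow> C_on n S f"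
proof (induction n arbitrary: f)
  case 0 then show ?case by (metis C_on.simps(1) C_on_imp_continuous_on)
next
  case (Suc n)
  then obtain g where "\<forall>x\<in>S. (f has_real_derivative g x) (at x)" "C_on (Suc n) S g"
    by (auto simp del: C_on.simps simp: C_on.simps(2)[of "Suc n"])
  then show ?case using Suc.IH[of g] by auto
qed

lemma C_on_add: "C_on n S f \<Longrightarrow> C_on n S g \<Longrightarrow> C_on n S (\<lambda>x. f x + g x)"
proof (induction n arbitrary: f g)
  case 0 then show ?case by (simp add: continuous_on_add)
next
  case (Suc n)
  then obtain f' g' where "\<forall>x\<in>S. (f has_real_derivative f' x) (at x)" "C_on n S f'"
    "\<forall>x\<in>S. (g has_real_derivative g' x) (at x)" "C_on n S g'" by auto
  then show ?case using Suc.IH[of f' g']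
    by (auto intro!: exI[of _ "\<lambda>x. f' x + g' x"] DERIV_add)
qed

lemma C_on_const: "C_on n S (\<lambda>x. c)"
proof (induction n arbitrary: c)
  case (Suc n)
  show ?case using Suc[of 0] by (auto intro!: exI[of _ "\<lambda>x. 0"] derivative_eq_intros)
qed simp

lemma C_on_cmult: "C_on n S f \<Longrightarrow> C_on n S (\<lambda>x. c * f x)"
proof (induction n arbitrary: f)
  case 0 then show ?case by (simp add: continuous_on_mult_left)
next
  case (Suc n)
  then obtain f' where "\<forall>x\<in>S. (f has_real_derivative f' x) (at x)" "C_on n S f'" by auto
  then show ?case using Suc.IH[of f']
    by (auto intro!: exI[of _ "\<lambda>x. c * f' x"] DERIV_cmult)
qed

lemma C_on_uminus: "C_on n S f \<Longrightarrow> C_on n S (\<lambda>x. - f x)"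
  using C_on_cmult[of n S f "-1"] by simp

lemma C_on_cmult_iff: "c \<noteq> 0 \<Longrightarrow> C_on n S (\<lambda>x. c * f x) \<longleftrightarrow> C_on n S f"
  using C_on_cmult[of n S "\<lambda>x. c * f x" "1/c"] C_on_cmult[of n S f c] by auto

lemma C_on_id: "C_on n S (\<lambda>x. x)"
proof (cases n)
  case (Suc k)
  then show ?thesis by (auto intro!: exI[of _ "\<lambda>x. 1"] C_on_const derivative_eq_intros)
qed simp

lemma C_on_shift: "C_on n {c<..} f \<Longrightarrow> C_on n {c+d<..} (\<lambda>x. f (x - d))"
proof (induction n arbitrary: f)
  case 0
  have "continuous_on {c+d<..} (\<lambda>x. f (x - d))"
    by (rule continuous_on_compose2[of "{c<..}" f]) (use 0 in \<open>auto intro!: continuous_intros\<close>)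
  then show ?case by simp
next
  case (Suc n)
  then obtain f' where f': "\<forall>x\<in>{c<..}. (f has_real_derivative f' x) (at x)" "C_on n {c<..} f'" by auto
  have "((\<lambda>x. f (x - d)) has_real_derivative f' (x - d)) (at x)" if "x > c + d" for x
    using DERIV_shift[of "f" "f' (x - d)" x "-d"] f'(1) that by auto
  then show ?case using Suc.IH[OF f'(2)] by (auto intro!: exI[of _ "\<lambda>x. f' (x - d)"])
qed

text \<open>Smoothness is local; the derivatives found on the various half-lines agree because derivatives are
unique.\<close>

lemma C_on_local:
  assumes "\<And>c. 0 < c \<Longrightarrow> C_on n {c<..} f"
  shows "C_on n {0<..} f"
  using assms
proof (induction n arbitrary: f)
  case 0
  have "isCont f x" if "0 < x" for x
    using 0[of "x/2"] that by (simp add: continuous_on_eq_continuous_at)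
  then show ?case by (simp add: continuous_on_eq_continuous_at)
next
  case (Suc n)
  have d: "(f has_real_derivative deriv f x) (at x)" if pos: "0 < x" for x
  proof -
    obtain f' where "\<forall>y\<in>{x/2<..}. (f has_real_derivative f' y) (at y)"
      using Suc.prems[OF half_gt_zero[OF pos]] unfolding C_on.simps by blast
    then have "(f has_real_derivative f' x) (at x)" using pos by auto
    then show ?thesis by (simp add: DERIV_imp_deriv)
  qed
  have "C_on n {c<..} (deriv f)" if "0 < c" for c
    using Suc.prems[OF that] C_on_Suc_iff[of "{c<..}" f "deriv f" n] d that by auto
  then show ?case using Suc.IH d by auto
qed

text \<open>Convolution with this function is integration from 0; its convolution square is the identity function
on the half-line.\<close>

definition heaviside :: "real \<Rightarrow> real" where
  "heaviside x = (if 0 < x then 1 else 0)"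

lemma power_dominated_heaviside: "power_dominated 1 heaviside"
proof (rule power_dominatedI)
  show "heaviside \<in> borel_measurable borel" unfolding heaviside_def[abs_def] by measurable
qed (auto simp: heaviside_def power_kernel_pos intro!: exI[of _ 1])

lemma volterra_heaviside: "volterra heaviside"
  unfolding volterra_def using power_dominated_heaviside zero_less_one by blast

lemma volterra_set_integrable:
  assumes "volterra f" shows "set_integrable lborel {0..x} f"
proof -
  note [measurable] = volterra_measurable[OF assms]
  have "integrable lborel (\<lambda>y. heaviside (x + 1 - y) * f y)"
    by (rule volterra_conv_integrable[OF volterra_heaviside assms])
  then show ?thesis unfolding set_integrable_def
    by (rule Bochner_Integration.integrable_bound) (auto simp: heaviside_def indicator_def)
qed

lemma conv_heaviside_eq_integral:
  assumes "volterra f"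
  shows "conv heaviside f x = integral {0..x} f"
proof -
  have "conv heaviside f x = (LBINT y:{0..x}. f y)"
    unfolding conv_def set_lebesgue_integral_def
  proof (rule integral_cong_AE)
    show "AE y in lborel. heaviside (x - y) * f y = indicat_real {0..x} y *\<^sub>R f y"
      using AE_lborel_singleton[of x]
      by eventually_elim (auto simp: heaviside_def indicator_def volterra_nonpos[OF assms])
  qed (use volterra_measurable[OF assms] volterra_measurable[OF volterra_heaviside] in measurable)
  then show ?thesis
    using set_borel_integral_eq_integral(2)[OF volterra_set_integrable[OF assms]] by simp
qed

lemma conv_heaviside_has_derivative:
  assumes f: "volterra f" and "0 < x" "isCont f x"
  shows "(conv heaviside f has_real_derivative f x) (at x)"
proof -
  have int: "f integrable_on {0..x+1}"
    by (rule set_borel_integral_eq_integral(1)[OF volterra_set_integrable[OF f]])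
  have "((\<lambda>u. integral {0..u} f) has_vector_derivative f x) (at x within {0..x+1})"
    by (rule integral_has_vector_derivative_continuous_at[of _ _ _ _ "{}", simplified])
      (use int assms in \<open>auto intro: continuous_at_imp_continuous_at_within\<close>)
  then have "((\<lambda>u. integral {0..u} f) has_vector_derivative f x) (at x within {0<..<x+1})"
    by (rule has_vector_derivative_within_subset) auto
  then have "((\<lambda>u. integral {0..u} f) has_vector_derivative f x) (at x)"
    using assms(2) by (subst (asm) at_within_open) auto
  then show ?thesis
    unfolding conv_heaviside_eq_integral[OF f, abs_def]
    by (simp add: has_real_derivative_iff_has_vector_derivative)
qed

lemma conv_heaviside_cancel:
  assumes f: "volterra f" and "continuous_on {0<..} f" and "conv heaviside f = (\<lambda>x. 0)"
  shows "f = (\<lambda>x. 0)"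
proof
  fix x
  show "f x = 0"
  proof (cases "0 < x")
    case True
    then have "isCont f x" using assms(2) by (simp add: continuous_on_eq_continuous_at)
    then have "((\<lambda>x. 0) has_real_derivative f x) (at x)"
      using conv_heaviside_has_derivative[OF f True] assms(3) by simp
    then show ?thesis using DERIV_unique[OF _ DERIV_const[of 0]] by blast
  qed (use volterra_nonpos[OF f] in simp)
qed

lemma C_on_conv_heaviside_iff:
  assumes f: "volterra f" and "0 \<le> c" and "continuous_on {c<..} f"
  shows "C_on (Suc n) {c<..} (conv heaviside f) \<longleftrightarrow> C_on n {c<..} f"
proof (rule C_on_Suc_iff)
  fix x assume "x \<in> {c<..}"
  then show "(conv heaviside f has_real_derivative f x) (at x)"
    using assms by (intro conv_heaviside_has_derivative) (auto simp: continuous_on_eq_continuous_at)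
qed simp

lemma C_on_conv_heaviside:
  assumes f: "volterra f" and "C_on n {0<..} f"
  shows "C_on (Suc n) {0<..} (conv heaviside f)"
  using assms C_on_conv_heaviside_iff[OF f] C_on_imp_continuous_on by auto

text \<open>Dominated convergence: only \<open>f\<close> is moved, and \<open>f\<close> is continuous off the origin, so for each \<open>x\<close> only
the single point \<open>y = x\<close> has to be excluded.\<close>

lemma continuous_on_conv_bounded:
  assumes f: "power_dominated 1 f" "continuous_on {0<..} f" and g: "volterra g"
  shows "continuous_on UNIV (conv f g)"
proof -
  have cf: "isCont f u" if "u \<noteq> 0" for u
  proof (cases "0 < u")
    case True then show ?thesis using f(2) by (simp add: continuous_on_eq_continuous_at)
  next
    case False
    have "continuous_on {..<0} f"
      by (rule continuous_on_eq[of _ "\<lambda>_. 0"]) (use power_dominated_nonpos[OF f(1)] in auto)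
    then show ?thesis using False that by (simp add: continuous_on_eq_continuous_at)
  qed
  note [measurable] = power_dominated_measurable[OF f(1)] volterra_measurable[OF g]
  show ?thesis
  proof (rule continuous_on_sequentiallyI)
    fix u :: "nat \<Rightarrow> real" and x assume u: "u \<longlonglongrightarrow> x"
    then obtain T where T: "\<And>n. u n < T"
      by (metis BseqE convergent_imp_Bseq convergentI abs_le_D1 real_norm_def gt_ex order.strict_trans1)
    obtain C where C: "0 \<le> C" "\<And>x. x \<le> T \<Longrightarrow> \<bar>f x\<bar> \<le> C * power_kernel 1 x"
      using power_dominated_bound[OF f(1)] by blast
    have C': "\<bar>f x\<bar> \<le> C" if "x \<le> T" for x
      using C(2)[OF that] C(1) by (cases "0 < x") (auto simp: power_kernel_pos)
    show "(\<lambda>n. conv f g (u n)) \<longlonglongrightarrow> conv f g x"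
      unfolding conv_def
    proof (rule integral_dominated_convergence[where w = "\<lambda>y. C * (heaviside (T - y) * \<bar>g y\<bar>)"])
      show "integrable lborel (\<lambda>y. C * (heaviside (T - y) * \<bar>g y\<bar>))"
        using volterra_conv_integrable[OF volterra_heaviside volterra_abs[OF g], of T] by simp
      show "AE y in lborel. (\<lambda>n. f (u n - y) * g y) \<longlonglongrightarrow> f (x - y) * g y"
        using AE_lborel_singleton[of x]
      proof eventually_elim
        case (elim y)
        then have "isCont f (x - y)" by (intro cf) auto
        moreover have "(\<lambda>n. u n - y) \<longlonglongrightarrow> x - y" by (intro tendsto_intros u)
        ultimately have "(\<lambda>n. f (u n - y)) \<longlonglongrightarrow> f (x - y)" by (rule isCont_tendsto_compose)
        then show ?case by (intro tendsto_intros)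
      qed
      fix n
      show "AE y in lborel. norm (f (u n - y) * g y) \<le> C * (heaviside (T - y) * \<bar>g y\<bar>)"
      proof (rule AE_I2)
        fix y
        show "norm (f (u n - y) * g y) \<le> C * (heaviside (T - y) * \<bar>g y\<bar>)"
        proof (cases "0 < y \<and> y < T")
          case True
          then have "\<bar>f (u n - y)\<bar> \<le> C" using T[of n] by (intro C') auto
          then show ?thesis using True by (simp add: abs_mult heaviside_def mult_right_mono)
        next
          case False
          then have "f (u n - y) * g y = 0"
            using volterra_nonpos[OF g, of y] power_dominated_nonpos[OF f(1), of "u n - y"] T[of n]
            by (cases "y \<le> 0") auto
          then have "norm (f (u n - y) * g y) = 0" by (simp only: norm_zero)
          also have "0 \<le> C * (heaviside (T - y) * \<bar>g y\<bar>)" using C(1) by (simp add: heaviside_def)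
          finally show ?thesis .
        qed
      qed
    qed measurable
  qed
qed

section \<open>Smoothness of convolutions\<close>

text \<open>Shifting away from the origin removes the singularity. A smooth function on \<open>(0, \<infinity>)\<close> then becomes
smooth up to the boundary and can be recovered from its derivative by integration, however badly its
derivatives behave near the origin.\<close>

definition shift_left :: "real \<Rightarrow> (real \<Rightarrow> real) \<Rightarrow> real \<Rightarrow> real" where
  "shift_left d f x = (if 0 < x then f (x + d) else 0)"

lemma power_dominated_1I:
  assumes "continuous_on {0<..} f" "\<And>x. x \<le> 0 \<Longrightarrow> f x = 0"
    and "\<And>T. 0 < T \<Longrightarrow> bounded (f ` {0<..T})"
  shows "power_dominated 1 f"
proof (rule power_dominatedI)
  have "(\<lambda>x. indicator {0<..} x *\<^sub>R f x) \<in> borel_measurable borel"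
    by (intro borel_measurable_continuous_on_indicator assms(1)) auto
  moreover have "(\<lambda>x. indicator {0<..} x *\<^sub>R f x) = f"
    using assms(2) by (auto simp: indicator_def fun_eq_iff)
  ultimately show "f \<in> borel_measurable borel" by simp
next
  fix T :: real assume "0 < T"
  from assms(3)[OF this] obtain C where "\<And>x. x \<in> {0<..T} \<Longrightarrow> \<bar>f x\<bar> \<le> C"
    unfolding bounded_iff by (metis image_eqI real_norm_def)
  then show "\<exists>C. \<forall>x. 0 < x \<and> x \<le> T \<longrightarrow> \<bar>f x\<bar> \<le> C * power_kernel 1 x"
    by (intro exI[of _ C]) (auto simp: power_kernel_pos)
qed (use assms in auto)

lemma continuous_on_shift_left:
  assumes "0 < d" "continuous_on {0<..} f"
  shows "continuous_on {0<..} (shift_left d f)"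
proof -
  have "continuous_on {0<..} (\<lambda>x. f (x + d))"
    by (rule continuous_on_compose2[OF assms(2)]) (use assms(1) in \<open>auto intro!: continuous_intros\<close>)
  then show ?thesis by (rule continuous_on_eq) (auto simp: shift_left_def)
qed

lemma power_dominated_shift_left:
  assumes "0 < d" "continuous_on {0<..} f"
  shows "power_dominated 1 (shift_left d f)"
proof (rule power_dominated_1I[OF continuous_on_shift_left[OF assms]])
  fix T :: real assume "0 < T"
  have "compact (f ` {d..T+d})"
    using assms by (intro compact_continuous_image continuous_on_subset[OF assms(2)]) auto
  then have "bounded (f ` {d..T+d})" by (rule compact_imp_bounded)
  moreover have "shift_left d f ` {0<..T} \<subseteq> f ` {d..T+d}"
    using assms(1) by (auto simp: shift_left_def)
  ultimately show "bounded (shift_left d f ` {0<..T})" by (rule bounded_subset)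
qed (simp add: shift_left_def)

lemma volterra_shift_left:
  "0 < d \<Longrightarrow> continuous_on {0<..} f \<Longrightarrow> volterra (shift_left d f)"
  unfolding volterra_def using power_dominated_shift_left zero_less_one by blast

lemma shift_left_eq_integral:
  assumes "0 < d" "continuous_on {0<..} f'"
    and f': "\<And>x. 0 < x \<Longrightarrow> (f has_real_derivative f' x) (at x)"
  shows "shift_left d f = (\<lambda>x. f d * heaviside x + conv heaviside (shift_left d f') x)"
proof
  fix x
  note v = volterra_shift_left[OF assms(1,2)]
  show "shift_left d f x = f d * heaviside x + conv heaviside (shift_left d f') x"
  proof (cases "0 < x")
    case True
    have "((\<lambda>y. f' (y + d)) has_integral f (x + d) - f (0 + d)) {0..x}"
    proof (rule fundamental_theorem_of_calculus)
      fix y assume "y \<in> {0..x}"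
      then have "((\<lambda>y. f (y + d)) has_real_derivative f' (y + d)) (at y)"
        using DERIV_shift[of f "f' (y + d)" y d] f'[of "y + d"] assms(1) by auto
      then show "((\<lambda>y. f (y + d)) has_vector_derivative f' (y + d)) (at y within {0..x})"
        by (simp add: has_real_derivative_iff_has_vector_derivative has_vector_derivative_at_within)
    qed (use True in simp)
    then have "(shift_left d f' has_integral f (x + d) - f d) {0..x}"
      by (subst has_integral_spike_finite_eq[of "{0}" _ "\<lambda>y. f' (y + d)"]) (auto simp: shift_left_def)
    then show ?thesis
      using True by (simp add: conv_heaviside_eq_integral[OF v] integral_unique shift_left_def heaviside_def)
  next
    case False
    then show ?thesis
      using volterra_nonpos[OF volterra_conv[OF volterra_heaviside v]]
      by (simp add: shift_left_def heaviside_def)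
  qed
qed

text \<open>Since \<open>shift_left d f\<close> is \<open>f d\<close> times the Heaviside function plus the integral of \<open>shift_left d f'\<close>,
the convolution with \<open>g\<close> is the integral of \<open>f d * g + conv (shift_left d f') g\<close>, a function of the same
form with one derivative of \<open>f\<close> used up.\<close>

lemma C_on_conv_shift_left:
  assumes "0 < d" "C_on m {0<..} f" and g: "volterra g" "C_on m {c<..} g" and "0 \<le> c"
  shows "C_on m {c<..} (conv (shift_left d f) g)"
  using assms(2,4)
proof (induction m arbitrary: f)
  case 0
  then have "continuous_on UNIV (conv (shift_left d f) g)"
    using assms by (intro continuous_on_conv_bounded power_dominated_shift_left continuous_on_shift_left) auto
  then show ?case using continuous_on_subset by (simp, blast)
next
  case (Suc m)
  then obtain f' where f': "\<And>x. 0 < x \<Longrightarrow> (f has_real_derivative f' x) (at x)" "C_on m {0<..} f'"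
    by auto
  note cf' = C_on_imp_continuous_on[OF f'(2)]
  note v = volterra_shift_left[OF assms(1) cf']
  let ?k = "\<lambda>x. f d * g x + conv (shift_left d f') g x"
  have vk: "volterra ?k" by (intro volterra_add volterra_cmult volterra_conv g v)
  have "conv (shift_left d f) g = conv (\<lambda>x. f d * heaviside x + conv heaviside (shift_left d f') x) g"
    using shift_left_eq_integral[OF assms(1) cf' f'(1)] by simp
  also have "\<dots> = (\<lambda>x. f d * conv heaviside g x + conv heaviside (conv (shift_left d f') g) x)"
    using g v volterra_heaviside
    by (simp add: conv_add_left conv_cmult_left conv_assoc volterra_cmult volterra_conv)
  also have "\<dots> = conv heaviside ?k"
    using g v volterra_heaviside
    by (simp add: conv_add_right conv_cmult_right volterra_cmult volterra_conv)
  finally have eq: "conv (shift_left d f) g = conv heaviside ?k" .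
  have "C_on m {c<..} ?k"
    using Suc.IH[OF f'(2)] C_on_SucD[OF Suc.prems(2)] by (intro C_on_add C_on_cmult) auto
  then show ?case
    unfolding eq using C_on_conv_heaviside_iff[OF vk assms(5)] C_on_imp_continuous_on by blast
qed

definition restrict_below :: "real \<Rightarrow> (real \<Rightarrow> real) \<Rightarrow> real \<Rightarrow> real" where
  "restrict_below d f x = (if x \<le> d then f x else 0)"

lemma volterra_restrict_below:
  assumes "volterra f" shows "volterra (restrict_below d f)"
proof -
  obtain a where a: "0 < a" "power_dominated a f" using assms by (auto simp: volterra_def)
  have "power_dominated a (restrict_below d f)"
  proof (rule power_dominatedI)
    show "restrict_below d f \<in> borel_measurable borel"
      using volterra_measurable[OF assms] unfolding restrict_below_def[abs_def] by measurable
    fix T :: real assume "0 < T"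
    obtain C where C: "0 \<le> C" "\<And>x. x \<le> T \<Longrightarrow> \<bar>f x\<bar> \<le> C * power_kernel a x"
      using power_dominated_bound[OF a(2)] by blast
    then have "\<bar>restrict_below d f x\<bar> \<le> C * power_kernel a x" if "x \<le> T" for x
      using that by (auto simp: restrict_below_def)
    then show "\<exists>C. \<forall>x. 0 < x \<and> x \<le> T \<longrightarrow> \<bar>restrict_below d f x\<bar> \<le> C * power_kernel a x"
      by blast
  qed (simp add: restrict_below_def volterra_nonpos[OF assms])
  then show ?thesis using a(1) by (auto simp: volterra_def)
qed

text \<open>For \<open>x > 2d\<close> the two arguments \<open>x - y\<close> and \<open>y\<close> cannot both be at most \<open>d\<close>. Hence in each part of the
convolution integral at least one of the factors is evaluated away from its singularity.\<close>

lemma conv_split: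
  assumes f: "volterra f" "continuous_on {0<..} f" and g: "volterra g" "continuous_on {0<..} g"
    and "0 < d" "2 * d < x"
  shows "conv f g x = conv (shift_left d f) g (x - d)
           + conv (shift_left d g) (restrict_below d f) (x - d)"
proof -
  note vr = volterra_restrict_below[OF f(1), of d]
  have "f u = restrict_below d f u + shift_left d f (u - d)" for u
    by (auto simp: restrict_below_def shift_left_def)
  then have "conv f g x = (\<integral>y. restrict_below d f (x - y) * g y + shift_left d f (x - d - y) * g y \<partial>lborel)"
    unfolding conv_def
    by (intro Bochner_Integration.integral_cong refl) (simp add: algebra_simps)
  also have "\<dots> = conv (restrict_below d f) g x + conv (shift_left d f) g (x - d)"
    unfolding conv_def
    using volterra_conv_integrable[OF vr g(1), of x]
      volterra_conv_integrable[OF volterra_shift_left[OF assms(5) f(2)] g(1), of "x - d"]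
    by (intro Bochner_Integration.integral_add) auto
  also have "conv (restrict_below d f) g x = conv g (restrict_below d f) x"
    by (simp add: conv_commute)
  also have "\<dots> = conv (shift_left d g) (restrict_below d f) (x - d)"
    unfolding conv_def
    using assms(6) by (intro Bochner_Integration.integral_cong) (auto simp: restrict_below_def shift_left_def)
  finally show ?thesis by simp
qed

text \<open>The derivatives of the factors may grow arbitrarily fast towards the origin: at a given point the split
of the integral always lets one differentiate the factor that is evaluated far from 0.\<close>

lemma C_on_conv:
  assumes f: "volterra f" "C_on m {0<..} f" and g: "volterra g" "C_on m {0<..} g"
  shows "C_on m {0<..} (conv f g)"
proof (rule C_on_local)
  fix c :: real assume "0 < c"
  define d where "d = c / 2"
  have d: "0 < d" "2 * d = c" using \<open>0 < c\<close> by (auto simp: d_def)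
  note cf = C_on_imp_continuous_on[OF f(2)] and cg = C_on_imp_continuous_on[OF g(2)]
  have "C_on m {d<..} (restrict_below d f)"
    by (rule C_on_cong[of _ "\<lambda>_. 0"]) (auto simp: restrict_below_def C_on_const)
  then have "C_on m {d<..} (conv (shift_left d g) (restrict_below d f))"
    using d g f by (intro C_on_conv_shift_left volterra_restrict_below) auto
  moreover have "C_on m {d<..} (conv (shift_left d f) g)"
    using d f g C_on_subset[OF g(2)] by (intro C_on_conv_shift_left) auto
  ultimately have "C_on m {d + d<..} (\<lambda>x. conv (shift_left d f) g (x - d)
      + conv (shift_left d g) (restrict_below d f) (x - d))"
    by (intro C_on_add C_on_shift)
  then have *: "C_on m {c<..} (\<lambda>x. conv (shift_left d f) g (x - d)
      + conv (shift_left d g) (restrict_below d f) (x - d))"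
    using d by simp
  show "C_on m {c<..} (conv f g)"
    by (rule C_on_cong[OF _ _ *])
      (use d conv_split[OF f(1) cf g(1) cg d(1)] in auto)
qed

section \<open>Convolution powers that are iterated integrals\<close>

abbreviation iterated_integral :: "nat \<Rightarrow> (real \<Rightarrow> real) \<Rightarrow> real \<Rightarrow> real" where
  "iterated_integral M \<equiv> conv heaviside ^^ M"

lemma volterra_iterated_integral: "volterra v \<Longrightarrow> volterra (iterated_integral M v)"
  by (induction M) (auto intro: volterra_conv volterra_heaviside)

lemma conv_iterated_integral:
  assumes "volterra v" "volterra w"
  shows "conv (iterated_integral M v) w = iterated_integral M (conv v w)"
proof (induction M)
  case (Suc M)
  then show ?case
    using conv_assoc[OF volterra_heaviside volterra_iterated_integral[OF assms(1)] assms(2)] by simp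
qed simp

lemma C_on_iterated_integral:
  assumes "volterra v" shows "C_on M {0<..} (iterated_integral (Suc M) v)"
proof (induction M)
  case 0
  have "continuous_on {0<..} heaviside"
    by (rule continuous_on_eq[of _ "\<lambda>_. 1"]) (auto simp: heaviside_def)
  then have "continuous_on UNIV (conv heaviside v)"
    by (intro continuous_on_conv_bounded power_dominated_heaviside assms)
  then show ?case using continuous_on_subset[of UNIV _ "{0<..}"] by simp
next
  case (Suc M)
  then show ?case
    using C_on_conv_heaviside[OF volterra_iterated_integral[OF assms, of "Suc M"], of M] by simp
qed

text \<open>The exponent is shifted: \<open>conv_pow h n\<close> is the convolution product of \<open>n + 1\<close> copies of \<open>h\<close>, as
the algebra has no unit.\<close>

primrec conv_pow :: "(real \<Rightarrow> real) \<Rightarrow> nat \<Rightarrow> real \<Rightarrow> real" where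
  "conv_pow h 0 = h"
| "conv_pow h (Suc n) = conv h (conv_pow h n)"

lemma volterra_conv_pow: "volterra h \<Longrightarrow> volterra (conv_pow h n)"
  by (induction n) (auto intro: volterra_conv)

lemma conv_conv_pow:
  "volterra h \<Longrightarrow> conv (conv_pow h m) (conv_pow h n) = conv_pow h (Suc (m + n))"
  by (induction m) (auto simp: conv_assoc volterra_conv_pow)

lemma power_dominated_conv_pow:
  assumes "power_dominated a h" "0 < a"
  shows "power_dominated (real (Suc n) * a) (conv_pow h n)"
proof (induction n)
  case (Suc n)
  have "power_dominated (a + real (Suc n) * a) (conv h (conv_pow h n))"
    using assms by (intro power_dominated_conv Suc) auto
  then show ?case by (simp add: algebra_simps)
qed (use assms in simp)

lemma C_on_conv_pow: "volterra h \<Longrightarrow> C_on m {0<..} h \<Longrightarrow> C_on m {0<..} (conv_pow h n)"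
  by (induction n) (auto intro: C_on_conv volterra_conv_pow)

lemma heaviside_eq_power_kernel: "heaviside = power_kernel 1"
  by (auto simp: heaviside_def power_kernel_def)

lemma conv_heaviside_heaviside: "conv heaviside heaviside x = x * heaviside x"
proof -
  have "Beta 1 1 = (1::real)" by (simp add: Beta_def Gamma_numeral)
  then show ?thesis
    using power_kernel_conv[of 1 1 x]
    by (auto simp: conv_def has_bochner_integral_iff heaviside_eq_power_kernel power_kernel_def
        indicator_def)
qed

text \<open>The Euler relation \<open>x h = heaviside * g\<close> says that the derivative of \<open>x h\<close> is no more singular than
\<open>h\<close>. Because multiplication by \<open>x\<close> is a derivation, it passes to all convolution powers, and there
the singularity of \<open>G\<close> gets weaker as the power grows.\<close>

lemma times_id_conv_pow:
  assumes h: "power_dominated a h" and g: "power_dominated a g" and a: "0 < a"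
    and eq: "\<And>x. x * h x = conv heaviside g x"
  shows "\<exists>G. power_dominated (real (Suc n) * a) G \<and> (\<forall>x. x * conv_pow h n x = conv heaviside G x)"
proof (induction n)
  case 0 then show ?case using g eq by auto
next
  case (Suc n)
  then obtain G where G: "power_dominated (real (Suc n) * a) G"
    "\<And>x. x * conv_pow h n x = conv heaviside G x" by auto
  have vol: "volterra h" "volterra g" "volterra G"
    by (rule volterraI[OF h a], rule volterraI[OF g a], rule volterraI[OF G(1)]) (use a in simp)
  note vn = volterra_conv_pow[OF vol(1), of n]
  let ?G = "\<lambda>x. conv g (conv_pow h n) x + conv h G x"
  have "power_dominated (a + real (Suc n) * a) ?G"
    using a by (intro power_dominated_add power_dominated_conv h g G power_dominated_conv_pow) auto
  moreover have "x * conv_pow h (Suc n) x = conv heaviside ?G x" for x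
  proof -
    have "x * conv_pow h (Suc n) x
        = conv (\<lambda>x. x * h x) (conv_pow h n) x + conv h (\<lambda>x. x * conv_pow h n x) x"
      using conv_times_id[OF vol(1) vn] by simp
    also have "\<dots> = conv (conv heaviside g) (conv_pow h n) x + conv h (conv heaviside G) x"
      unfolding eq G(2) by simp
    also have "\<dots> = conv heaviside ?G x"
      using vol vn volterra_heaviside
      by (simp add: conv_assoc conv_left_commute[of h] conv_add_right volterra_conv)
    finally show ?thesis .
  qed
  ultimately show ?case by (intro exI[of _ ?G]) (simp add: algebra_simps)
qed

text \<open>The map that sends \<open>d\<close> to its mean over \<open>(0, x)\<close> multiplies the constant in the bound
\<open>|d x| \<le> C x^(b-1)\<close> by \<open>1/b\<close>. As \<open>b > 1\<close>, it is a contraction, and the only fixed point is 0.\<close>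

lemma times_id_eq_conv_heaviside_imp_zero:
  assumes d: "power_dominated b d" and b: "1 < b" and eq: "\<And>x. x * d x = conv heaviside d x"
  shows "d = (\<lambda>x. 0)"
proof
  fix x
  obtain C where C: "0 \<le> C" "\<And>y. y \<le> x \<Longrightarrow> \<bar>d y\<bar> \<le> C * power_kernel b y"
    using power_dominated_bound[OF d] by blast
  have "\<bar>d y\<bar> \<le> C / b ^ k * power_kernel b y" if "y \<le> x" for k y
    using that
  proof (induction k arbitrary: y)
    case 0 then show ?case using C by simp
  next
    case (Suc k)
    show ?case
    proof (cases "0 < y")
      case True
      have bb: "Beta b 1 = 1 / b"
      proof -
        have "Gamma (b + 1) = b * Gamma b"
          using b by (intro Gamma_plus1) (auto elim!: nonpos_Ints_cases)
        then show ?thesis using b less_imp_neq[OF Gamma_real_pos[of b]] by (simp add: Beta_def)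
      qed
      have K: "has_bochner_integral lborel (\<lambda>z. C / b ^ k * (power_kernel 1 (y - z) * power_kernel b z))
          (C / b ^ k * (Beta b 1 * power_kernel (1 + b) y))"
        using b by (intro has_bochner_integral_mult_right power_kernel_conv) auto
      have "y * \<bar>d y\<bar> = \<bar>conv heaviside d y\<bar>"
        using arg_cong[OF eq[of y], of abs] True by (simp add: abs_mult)
      also have "\<dots> \<le> (\<integral>z. \<bar>heaviside (y - z) * d z\<bar> \<partial>lborel)"
        unfolding conv_def using integral_norm_bound[of lborel "\<lambda>z. heaviside (y - z) * d z"] by simp
      also have "\<dots> \<le> (\<integral>z. C / b ^ k * (power_kernel 1 (y - z) * power_kernel b z) \<partial>lborel)"
      proof (intro integral_mono)
        show "integrable lborel (\<lambda>z. \<bar>heaviside (y - z) * d z\<bar>)"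
          using conv_integrable[OF power_dominated_heaviside d] b by auto
        fix z
        show "\<bar>heaviside (y - z) * d z\<bar> \<le> C / b ^ k * (power_kernel 1 (y - z) * power_kernel b z)"
          using Suc.IH[of z] Suc.prems by (auto simp: heaviside_def power_kernel_def)
      qed (use K in \<open>simp add: has_bochner_integral_iff\<close>)
      also have "\<dots> = C / b ^ Suc k * y powr b"
        using K b True by (simp add: has_bochner_integral_iff bb power_kernel_pos)
      also have "y powr b = y * y powr (b - 1)"
        using True powr_add[of y 1 "b - 1"] by simp
      finally have "y * \<bar>d y\<bar> \<le> y * (C / b ^ Suc k * power_kernel b y)"
        using True by (simp add: power_kernel_pos mult_ac)
      then show ?thesis using True by (simp only: mult_le_cancel_left_pos)
    qed (use power_dominated_nonpos[OF d] in simp)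
  qed
  from this[of x] have le: "\<bar>d x\<bar> \<le> C / b ^ k * power_kernel b x" for k by simp
  have "(\<lambda>k. C / b ^ k * power_kernel b x) \<longlonglongrightarrow> 0 * power_kernel b x"
    using b by (intro tendsto_mult tendsto_const LIMSEQ_divide_realpow_zero)
  then have "\<bar>d x\<bar> \<le> 0" using le by (intro LIMSEQ_le_const) auto
  then show "d x = 0" by simp
qed

text \<open>If \<open>x F\<close> is absolutely continuous, so is \<open>F\<close> away from 0, and the quotient rule gives its derivative
\<open>u = (G - F)/x\<close>. For \<open>b > 1\<close> this is integrable at 0 and \<open>F\<close> tends to 0 there, so that \<open>F\<close> is the
integral of \<open>u\<close>. The proof compares Euler relations: both \<open>y = F\<close> and the integral \<open>y\<close> of \<open>u\<close> satisfy
\<open>x y = heaviside * (y + G - F)\<close>, and their difference vanishes by uniqueness.\<close>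

lemma obtain_density:
  assumes F: "power_dominated b F" and G: "power_dominated b G" and b: "1 < b"
    and eq: "\<And>x. x * F x = conv heaviside G x"
  obtains u where "power_dominated (b - 1) u" "F = conv heaviside u"
proof -
  define u where "u = (\<lambda>x. (G x - F x) / x)"
  have u: "power_dominated (b - 1) u"
  proof (rule power_dominatedI)
    show "u \<in> borel_measurable borel"
      using power_dominated_measurable[OF F] power_dominated_measurable[OF G]
      unfolding u_def by measurable
    show "u x = 0" if "x \<le> 0" for x
      using that power_dominated_nonpos[OF F] power_dominated_nonpos[OF G] by (simp add: u_def)
    fix T :: real assume "0 < T"
    have GF: "power_dominated b (\<lambda>x. G x + (-1) * F x)"
      by (intro power_dominated_add power_dominated_cmult F G)
    obtain C where C: "\<And>x. x \<le> T \<Longrightarrow> \<bar>G x + (-1) * F x\<bar> \<le> C * power_kernel b x"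
      using power_dominated_bound[OF GF] by blast
    have "\<bar>u x\<bar> \<le> C * power_kernel (b - 1) x" if "0 < x" "x \<le> T" for x
    proof -
      have "x powr (b - 1) = x * x powr (b - 1 - 1)"
        using that powr_add[of x 1 "b - 1 - 1"] by simp
      then have "x * \<bar>u x\<bar> \<le> x * (C * power_kernel (b - 1) x)"
        using C[OF that(2)] that(1) by (simp add: u_def abs_mult power_kernel_pos mult_ac)
      then show ?thesis using that(1) by (simp only: mult_le_cancel_left_pos)
    qed
    then show "\<exists>C. \<forall>x. 0 < x \<and> x \<le> T \<longrightarrow> \<bar>u x\<bar> \<le> C * power_kernel (b - 1) x" by blast
  qed
  have xu: "(\<lambda>x. x * u x) = (\<lambda>x. G x + (-1) * F x)"
    using power_dominated_nonpos[OF F, of 0] power_dominated_nonpos[OF G, of 0]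
    by (auto simp: u_def fun_eq_iff)
  let ?v = "conv heaviside u"
  have vol: "volterra u" "volterra F" "volterra G" "volterra ?v"
    using volterraI[OF u] volterraI[OF F] volterraI[OF G] b volterra_conv[OF volterra_heaviside]
    by auto
  have xv: "x * ?v x = conv heaviside ?v x + (conv heaviside G x - conv heaviside F x)" for x
  proof -
    have "(\<lambda>x. x * heaviside x) = conv heaviside heaviside"
      using conv_heaviside_heaviside by auto
    then have "x * ?v x = conv (conv heaviside heaviside) u x + conv heaviside (\<lambda>x. G x + (-1) * F x) x"
      using conv_times_id[OF volterra_heaviside vol(1), of x] xu by simp
    also have "conv (conv heaviside heaviside) u = conv heaviside ?v"
      using vol volterra_heaviside by (simp add: conv_assoc)
    also have "conv heaviside (\<lambda>x. G x + (-1) * F x) x = conv heaviside G x - conv heaviside F x"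
      using conv_add_right[OF vol(3) volterra_cmult[OF vol(2), of "-1"] volterra_heaviside]
        conv_cmult_right[of heaviside "-1" F] by simp
    finally show ?thesis by simp
  qed
  have "(\<lambda>x. ?v x + (-1) * F x) = (\<lambda>x. 0)"
  proof (rule times_id_eq_conv_heaviside_imp_zero[OF _ b])
    have "power_dominated (1 + (b - 1)) ?v"
      using b by (intro power_dominated_conv power_dominated_heaviside u) auto
    then show "power_dominated b (\<lambda>x. ?v x + (-1) * F x)"
      by (intro power_dominated_add power_dominated_cmult F) auto
    fix x
    show "x * (?v x + (-1) * F x) = conv heaviside (\<lambda>x. ?v x + (-1) * F x) x"
      using xv[of x] eq[of x] conv_add_right[OF vol(4) volterra_cmult[OF vol(2), of "-1"] volterra_heaviside]
        conv_cmult_right[of heaviside "-1" F] by (simp add: algebra_simps)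
  qed
  then have "F = ?v" by (auto simp: fun_eq_iff)
  then show ?thesis using that u by blast
qed

text \<open>Some convolution power of \<open>h\<close> is an \<open>M\<close>-fold integral, for every \<open>M\<close>. This makes the remainder
of the Neumann expansion as smooth as desired.\<close>

definition eventually_smoothing :: "(real \<Rightarrow> real) \<Rightarrow> bool" where
  "eventually_smoothing h \<longleftrightarrow>
     (\<forall>M. \<exists>N v. volterra v \<and> conv_pow h N = iterated_integral M v)"

text \<open>Once the exponent \<open>(n + 1) a\<close> exceeds 1, the corresponding power of \<open>h\<close> is an integral
\<open>heaviside * u\<close>. The \<open>M\<close>-th power of this power is then an \<open>M\<close>-fold integral.\<close>

lemma eventually_smoothingI:
  assumes h: "power_dominated a h" and g: "power_dominated a g" and a: "0 < a"
    and eq: "\<And>x. x * h x = conv heaviside g x"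
  shows "eventually_smoothing h"
  unfolding eventually_smoothing_def
proof
  fix M
  have vh: "volterra h" using h a by (auto simp: volterra_def)
  obtain n where n: "1 < real n * a" using reals_Archimedean3[OF a] by blast
  then have n': "1 < real (Suc n) * a" using a by (simp add: algebra_simps)
  obtain G where G: "power_dominated (real (Suc n) * a) G" "\<And>x. x * conv_pow h n x = conv heaviside G x"
    using times_id_conv_pow[OF h g a eq] by blast
  obtain u where "power_dominated (real (Suc n) * a - 1) u" and u: "conv_pow h n = conv heaviside u"
    using obtain_density[OF power_dominated_conv_pow[OF h a] G(1) n' G(2)] by blast
  then have vu: "volterra u" using n' unfolding volterra_def by (intro exI conjI) auto
  show "\<exists>N v. volterra v \<and> conv_pow h N = iterated_integral M v"
  proof (induction M)
    case 0
    show ?case using vh by (intro exI[of _ 0] exI[of _ h]) auto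
  next
    case (Suc M)
    then obtain N v where v: "volterra v" "conv_pow h N = iterated_integral M v" by blast
    have "conv_pow h (Suc (n + N)) = conv (conv heaviside u) (iterated_integral M v)"
      using conv_conv_pow[OF vh, of n N] u v by simp
    also have "\<dots> = conv heaviside (conv (iterated_integral M v) u)"
      using conv_assoc[OF volterra_heaviside vu volterra_iterated_integral[OF v(1)]] conv_commute by simp
    also have "\<dots> = iterated_integral (Suc M) (conv v u)"
      using conv_iterated_integral[OF v(1) vu] by simp
    finally show ?case
      using volterra_conv[OF v(1) vu]
      by (intro exI[of _ "Suc (n + N)"] exI[of _ "conv v u"] conjI)
  qed
qed

section \<open>Neumann expansions and resolvents\<close>

definition neumann_sum :: "(real \<Rightarrow> real) \<Rightarrow> nat \<Rightarrow> real \<Rightarrow> real" where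
  "neumann_sum h N x = (\<Sum>j<N. (-1) ^ Suc j * conv_pow h j x)"

lemma neumann_sum_0: "neumann_sum h 0 = (\<lambda>x. 0)"
  and neumann_sum_Suc:
    "neumann_sum h (Suc N) = (\<lambda>x. neumann_sum h N x + (-1) ^ Suc N * conv_pow h N x)"
  by (auto simp: neumann_sum_def fun_eq_iff)

lemma volterra_neumann_sum: "volterra h \<Longrightarrow> volterra (neumann_sum h N)"
  by (induction N) (auto simp: neumann_sum_0 neumann_sum_Suc simp del: power_Suc
      intro!: volterra_zero volterra_add volterra_cmult volterra_conv_pow)

lemma C_on_neumann_sum:
  "volterra h \<Longrightarrow> C_on m {0<..} h \<Longrightarrow> C_on m {0<..} (neumann_sum h N)"
  by (induction N) (auto simp: neumann_sum_0 neumann_sum_Suc simp del: power_Suc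
      intro!: C_on_const C_on_add C_on_cmult C_on_conv_pow)

text \<open>The equation \<open>f = g - h * f\<close> substituted into itself finitely often; the remainder is kept, as it
will turn out to be smooth.\<close>

lemma neumann_expansion:
  assumes h: "volterra h" and f: "volterra f" and g: "volterra g"
    and eq: "f = (\<lambda>x. g x - conv h f x)"
  shows "f = (\<lambda>x. g x + conv (neumann_sum h N) g x + (-1) ^ Suc N * conv (conv_pow h N) f x)"
proof (induction N)
  case 0
  have "conv (\<lambda>x. 0) g = (\<lambda>x. 0)" by (simp add: conv_def fun_eq_iff)
  then have "g x + conv (neumann_sum h 0) g x + (-1) ^ Suc 0 * conv (conv_pow h 0) f x = f x" for x
    using fun_cong[OF eq, of x] by (simp add: neumann_sum_0)
  then show ?case by auto
next
  case (Suc N)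
  note vN = volterra_conv_pow[OF h, of N]
  have "f = (\<lambda>x. g x + (-1) * conv h f x)"
  proof
    fix x show "f x = g x + (-1) * conv h f x" using fun_cong[OF eq, of x] by simp
  qed
  then have "conv (conv_pow h N) f = conv (conv_pow h N) (\<lambda>x. g x + (-1) * conv h f x)"
    by (rule arg_cong)
  also have "\<dots> = (\<lambda>x. conv (conv_pow h N) g x + (-1) * conv (conv_pow h N) (conv h f) x)"
    using conv_add_right[OF g volterra_cmult[OF volterra_conv[OF h f], of "-1"] vN]
      conv_cmult_right[of "conv_pow h N" "-1" "conv h f"] by simp
  also have "conv (conv_pow h N) (conv h f) = conv (conv_pow h (Suc N)) f"
    using conv_left_commute[OF vN h f] conv_assoc[OF h vN f] by simp
  finally have 1: "conv (conv_pow h N) f x = conv (conv_pow h N) g x - conv (conv_pow h (Suc N)) f x" for x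
    by simp
  have 2: "conv (neumann_sum h (Suc N)) g x
      = conv (neumann_sum h N) g x + (-1) ^ Suc N * conv (conv_pow h N) g x" for x
    unfolding neumann_sum_Suc
    using conv_add_left[OF volterra_neumann_sum[OF h] volterra_cmult[OF vN] g]
      conv_cmult_left[of _ "conv_pow h N" g] by (simp del: power_Suc)
  show ?case
  proof
    fix x
    show "f x = g x + conv (neumann_sum h (Suc N)) g x
        + (-1) ^ Suc (Suc N) * conv (conv_pow h (Suc N)) f x"
      using fun_cong[OF Suc.IH, of x] unfolding 1 2 by (simp add: algebra_simps)
  qed
qed

text \<open>In the finite expansion of \<open>r = - h + h * h - \<dots>\<close> each power of \<open>h\<close> is as smooth as \<open>h\<close> away from 0,
and the remainder is smooth because it contains a high power of \<open>h\<close> as a factor.\<close>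

lemma C_on_resolvent:
  assumes h: "volterra h" and r: "volterra r" and sm: "eventually_smoothing h"
    and eq: "r = (\<lambda>x. - h x - conv h r x)" and C: "C_on m {0<..} h"
  shows "C_on m {0<..} r"
proof -
  obtain N v where v: "volterra v" "conv_pow h N = iterated_integral (Suc m) v"
    using sm unfolding eventually_smoothing_def by blast
  have "C_on m {0<..} (\<lambda>x. - h x + conv (neumann_sum h N) (\<lambda>x. - h x) x
      + (-1) ^ Suc N * conv (conv_pow h N) r x)"
    unfolding v(2) conv_iterated_integral[OF v(1) r]
    by (intro C_on_add C_on_cmult C_on_conv C_on_uminus C_on_neumann_sum C_on_iterated_integral
        volterra_neumann_sum volterra_uminus volterra_conv h r v C)
  then show ?thesis
    using neumann_expansion[OF h r volterra_uminus[OF h] eq, of N] by (rule ssubst[rotated])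
qed

text \<open>With \<open>\<delta>\<close> for the unit of convolution, \<open>r = - h * (\<delta> + r)\<close>. Therefore the powers of \<open>r\<close> are those
of \<open>h\<close> times powers of \<open>\<delta> + r\<close>, and the latter are again of the form \<open>\<delta> + e\<close>.\<close>

lemma conv_pow_resolvent:
  assumes h: "volterra h" and r: "volterra r" and eq: "r = (\<lambda>x. - h x - conv h r x)"
  shows "\<exists>e. volterra e \<and>
    conv_pow r N = (\<lambda>x. (-1) ^ Suc N * (conv_pow h N x + conv (conv_pow h N) e x))"
proof (induction N)
  case 0
  show ?case
  proof (intro exI conjI ext)
    show "volterra r" by (rule r)
    fix x
    show "conv_pow r 0 x = (-1) ^ Suc 0 * (conv_pow h 0 x + conv (conv_pow h 0) r x)"
      using fun_cong[OF eq, of x] by simp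
  qed
next
  case (Suc N)
  then obtain e where e: "volterra e"
    "conv_pow r N = (\<lambda>x. (-1) ^ Suc N * (conv_pow h N x + conv (conv_pow h N) e x))" by blast
  let ?H = "conv_pow h N" and ?e = "\<lambda>x. r x + (e x + conv r e x)"
  note vH = volterra_conv_pow[OF h, of N]
  let ?b = "\<lambda>x. ?H x + conv ?H e x"
  have vb: "volterra ?b" by (intro volterra_add volterra_conv vH e)
  have ve: "volterra ?e" by (intro volterra_add volterra_conv r e)
  have "r = (\<lambda>x. (-1) * (h x + conv h r x))"
  proof
    fix x show "r x = (-1) * (h x + conv h r x)" using fun_cong[OF eq, of x] by simp
  qed
  then have "conv r ?b = conv (\<lambda>x. (-1) * (h x + conv h r x)) ?b"
    by (rule arg_cong)
  also have "\<dots> = (\<lambda>x. (-1) * (conv h ?b x + conv (conv h r) ?b x))"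
    using vb h r by (simp only: conv_cmult_left conv_add_left volterra_conv)
  also have "conv h ?b = (\<lambda>x. conv h ?H x + conv (conv h ?H) e x)"
    using vH e h by (simp add: conv_add_right volterra_conv conv_assoc)
  also have "conv (conv h r) ?b = (\<lambda>x. conv (conv h ?H) r x + conv (conv h ?H) (conv r e) x)"
  proof -
    have 1: "conv (conv h r) ?H = conv (conv h ?H) r"
      using conv_assoc[OF h r vH] conv_assoc[OF h vH r] conv_commute[of r ?H] by simp
    have "conv (conv h r) (conv ?H e) = conv (conv (conv h r) ?H) e"
      using conv_assoc[OF volterra_conv[OF h r] vH e(1)] by simp
    also have "\<dots> = conv (conv h ?H) (conv r e)"
      unfolding 1 using conv_assoc[OF volterra_conv[OF h vH] r e(1)] by simp
    finally show ?thesis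
      using conv_add_right[OF vH volterra_conv[OF vH e(1)] volterra_conv[OF h r]] 1 by simp
  qed
  finally have b: "conv r ?b x = - (conv h ?H x + conv (conv h ?H) ?e x)" for x
    using conv_add_right[OF r volterra_add[OF e(1) volterra_conv[OF r e(1)]] volterra_conv[OF h vH]]
      conv_add_right[OF e(1) volterra_conv[OF r e(1)] volterra_conv[OF h vH]]
    by (simp add: algebra_simps)
  have "conv_pow r (Suc N) = (\<lambda>x. (-1) ^ Suc N * conv r ?b x)"
    using e(2) by (simp only: conv_pow.simps conv_cmult_right)
  also have "\<dots> = (\<lambda>x. (-1) ^ Suc (Suc N) * (conv_pow h (Suc N) x + conv (conv_pow h (Suc N)) ?e x))"
    unfolding b by (rule ext) (simp add: algebra_simps)
  finally show ?case using ve by blast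
qed

text \<open>This is what makes the situation symmetric. The smoothing power of \<open>h\<close> is a factor of the same power
of \<open>r\<close>, so the property passes to \<open>r\<close> without any estimate of \<open>r'\<close> near the origin.\<close>

lemma eventually_smoothing_resolvent:
  assumes h: "volterra h" and r: "volterra r" and sm: "eventually_smoothing h"
    and eq: "r = (\<lambda>x. - h x - conv h r x)"
  shows "eventually_smoothing r"
  unfolding eventually_smoothing_def
proof
  fix M
  obtain N v where v: "volterra v" "conv_pow h N = iterated_integral M v"
    using sm unfolding eventually_smoothing_def by blast
  obtain e where e: "volterra e"
    "conv_pow r N = (\<lambda>x. (-1) ^ Suc N * (conv_pow h N x + conv (conv_pow h N) e x))"
    using conv_pow_resolvent[OF h r eq] by blast
  have lin: "iterated_integral M (\<lambda>x. c * (f x + g x))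
      = (\<lambda>x. c * (iterated_integral M f x + iterated_integral M g x))"
    if "volterra f" "volterra g" for c f g
    using that
    by (induction M) (simp_all add: conv_cmult_right conv_add_right volterra_heaviside volterra_iterated_integral)
  have "conv_pow r N = iterated_integral M (\<lambda>x. (-1) ^ Suc N * (v x + conv v e x))"
    unfolding e(2) v(2) conv_iterated_integral[OF v(1) e(1)]
    using lin[OF v(1) volterra_conv[OF v(1) e(1)]] by (simp del: power_Suc)
  then show "\<exists>N w. volterra w \<and> conv_pow r N = iterated_integral M w"
    using volterra_cmult[OF volterra_add[OF v(1) volterra_conv[OF v(1) e(1)]]] by blast
qed

text \<open>The relation \<open>r + h + h * r = 0\<close> is symmetric in \<open>h\<close> and \<open>r\<close>, and both are eventually smoothing.\<close>

lemma C_on_resolvent_iff: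
  assumes h: "volterra h" and r: "volterra r" and sm: "eventually_smoothing h"
    and eq: "r = (\<lambda>x. - h x - conv h r x)"
  shows "C_on m {0<..} r \<longleftrightarrow> C_on m {0<..} h"
proof
  have eq': "h = (\<lambda>x. - r x - conv r h x)"
  proof
    fix x show "h x = - r x - conv r h x"
      using fun_cong[OF eq, of x] by (simp add: conv_commute[of r h])
  qed
  assume "C_on m {0<..} r"
  then show "C_on m {0<..} h"
    using C_on_resolvent[OF r h eventually_smoothing_resolvent[OF h r sm eq] eq'] by blast
next
  assume "C_on m {0<..} h"
  then show "C_on m {0<..} r" using C_on_resolvent[OF h r sm eq] by blast
qed

text \<open>Formally \<open>w = J * (\<delta> + h)^(-1)\<close> with \<open>J = heaviside * heaviside\<close>, so that \<open>r\<close> is the second derivative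
of \<open>w\<close> on the open half-line. The resolvent is not constructed from an infinite series: a finite expansion
of \<open>w\<close> whose remainder is a threefold integral exhibits \<open>w - J\<close> as a double integral of an explicit,
continuous \<open>r\<close>, and differentiating the equation twice gives the resolvent relation.\<close>

lemma obtain_resolvent:
  assumes h: "volterra h" "continuous_on {0<..} h" and sm: "eventually_smoothing h"
    and w: "volterra w" and eq: "w = (\<lambda>x. conv heaviside heaviside x - conv h w x)"
  obtains r where "volterra r" "continuous_on {0<..} r" "r = (\<lambda>x. - h x - conv h r x)"
    "w = (\<lambda>x. conv heaviside heaviside x + conv heaviside (conv heaviside r) x)"
proof -
  note vI = volterra_heaviside
  let ?J = "conv heaviside heaviside"
  have vJ: "volterra ?J" by (intro volterra_conv vI)
  \<comment> \<open>Two of the three integrations produce \<open>J\<close>, the third one makes \<open>z\<close> continuous.\<close>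
  obtain N v where v: "volterra v" "conv_pow h N = iterated_integral 3 v"
    using sm unfolding eventually_smoothing_def by blast
  define z where "z = conv heaviside (conv v w)"
  define r where "r = (\<lambda>x. neumann_sum h N x + (-1) ^ Suc N * z x)"
  have vz: "volterra z" unfolding z_def by (intro volterra_conv vI v w)
  have vs: "volterra (neumann_sum h N)" by (rule volterra_neumann_sum[OF h(1)])
  have vr: "volterra r" unfolding r_def by (intro volterra_add volterra_cmult vs vz)
  have "C_on 0 {0<..} z"
    using C_on_iterated_integral[OF volterra_conv[OF v(1) w], of 0] by (simp add: z_def)
  then have "C_on 0 {0<..} r"
    unfolding r_def using h by (intro C_on_add C_on_cmult C_on_neumann_sum) auto
  then have cr: "continuous_on {0<..} r" by simp
  have J_assoc: "conv ?J f = conv heaviside (conv heaviside f)" if "volterra f" for f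
    using conv_assoc[OF vI vI that] by simp
  have "conv (conv_pow h N) w = conv ?J z"
    unfolding v(2) conv_iterated_integral[OF v(1) w] J_assoc[OF vz]
    by (simp add: z_def eval_nat_numeral)
  moreover have "conv ?J r x = conv ?J (neumann_sum h N) x + (-1) ^ Suc N * conv ?J z x" for x
    unfolding r_def using conv_add_right[OF vs volterra_cmult[OF vz] vJ]
      conv_cmult_right[of ?J _ z] by (simp del: power_Suc)
  ultimately have "w x = ?J x + conv ?J r x" for x
    using fun_cong[OF neumann_expansion[OF h(1) w vJ eq, of N], of x]
      conv_commute[of ?J "neumann_sum h N"] by simp
  then have w_eq: "w = (\<lambda>x. ?J x + conv ?J r x)" by blast
  let ?d = "\<lambda>x. r x + (h x + conv h r x)"
  have vd: "volterra ?d" by (intro volterra_add volterra_conv vr h)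
  have "C_on 0 {0<..} ?d"
    using cr h vr by (intro C_on_add C_on_conv) auto
  then have cd: "continuous_on {0<..} ?d" by simp
  have "conv heaviside (conv heaviside ?d) = (\<lambda>x. 0)"
  proof
    fix x
    have "conv heaviside (conv heaviside ?d) x = conv ?J ?d x"
      using J_assoc[OF vd] by simp
    also have "\<dots> = conv ?J r x + (conv ?J h x + conv ?J (conv h r) x)"
      using vr h vJ by (simp add: conv_add_right volterra_conv volterra_add)
    also have "conv ?J h x + conv ?J (conv h r) x = conv h w x"
      using vr h vJ conv_commute[of ?J h] conv_left_commute[OF vJ h(1) vr]
      unfolding arg_cong[OF w_eq, of "conv h"] by (simp add: conv_add_right volterra_conv)
    also have "conv ?J r x = w x - ?J x" using fun_cong[OF w_eq, of x] by simp
    finally show "conv heaviside (conv heaviside ?d) x = 0"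
      using fun_cong[OF eq, of x] by simp
  qed
  moreover have "continuous_on {0<..} (conv heaviside ?d)"
    using C_on_imp_continuous_on[OF C_on_conv_heaviside[OF vd \<open>C_on 0 {0<..} ?d\<close>]] .
  ultimately have "conv heaviside ?d = (\<lambda>x. 0)"
    using conv_heaviside_cancel volterra_conv[OF vI vd] by blast
  then have "?d = (\<lambda>x. 0)" using conv_heaviside_cancel[OF vd cd] by blast
  then have d0: "r x + (h x + conv h r x) = 0" for x by (rule fun_cong)
  have "r = (\<lambda>x. - h x - conv h r x)"
  proof
    fix x show "r x = - h x - conv h r x" using d0[of x] by linarith
  qed
  moreover have "w = (\<lambda>x. ?J x + conv heaviside (conv heaviside r) x)"
    using w_eq unfolding J_assoc[OF vr] .
  ultimately show ?thesis by (rule that[OF vr cr])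
qed

theorem C_on_volterra_solution_iff:
  assumes h: "volterra h" "continuous_on {0<..} h" and sm: "eventually_smoothing h"
    and w: "volterra w" and eq: "w = (\<lambda>x. conv heaviside heaviside x - conv h w x)"
  shows "C_on (m + 2) {0<..} w \<longleftrightarrow> C_on m {0<..} h"
proof -
  obtain r where r: "volterra r" "continuous_on {0<..} r" "r = (\<lambda>x. - h x - conv h r x)"
    and w_eq: "w = (\<lambda>x. conv heaviside heaviside x + conv heaviside (conv heaviside r) x)"
    using obtain_resolvent[OF assms] by blast
  have J: "C_on k {0<..} (conv heaviside heaviside)" for k
    by (rule C_on_cong[of _ "\<lambda>x. x"]) (auto simp: conv_heaviside_heaviside heaviside_def C_on_id)
  let ?R = "conv heaviside (conv heaviside r)"
  have "C_on (Suc (Suc m)) {0<..} w \<longleftrightarrow> C_on (Suc (Suc m)) {0<..} ?R"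
  proof
    assume "C_on (Suc (Suc m)) {0<..} w"
    then have "C_on (Suc (Suc m)) {0<..} (\<lambda>x. w x + - conv heaviside heaviside x)"
      by (intro C_on_add C_on_uminus J)
    then show "C_on (Suc (Suc m)) {0<..} ?R" unfolding w_eq by (simp del: C_on.simps)
  next
    assume "C_on (Suc (Suc m)) {0<..} ?R"
    then show "C_on (Suc (Suc m)) {0<..} w" unfolding w_eq by (intro C_on_add J)
  qed
  also have "\<dots> \<longleftrightarrow> C_on (Suc m) {0<..} (conv heaviside r)"
    using C_on_imp_continuous_on[OF C_on_conv_heaviside[OF r(1), of 0]] r(2)
    by (intro C_on_conv_heaviside_iff volterra_conv volterra_heaviside r(1)) simp_all
  also have "\<dots> \<longleftrightarrow> C_on m {0<..} r"
    using r(2) by (intro C_on_conv_heaviside_iff r(1)) simp_all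
  also have "\<dots> \<longleftrightarrow> C_on m {0<..} h"
    by (rule C_on_resolvent_iff[OF h(1) r(1) sm r(3)])
  finally show ?thesis by (simp del: C_on.simps)
qed

section \<open>Laplace transforms\<close>

definition laplace :: "(real \<Rightarrow> real) \<Rightarrow> real \<Rightarrow> real" where
  "laplace f \<theta> = (\<integral>x. exp (- \<theta> * x) * f x \<partial>lborel)"

definition laplace_integrable :: "(real \<Rightarrow> real) \<Rightarrow> real \<Rightarrow> bool" where
  "laplace_integrable f \<theta> \<longleftrightarrow> integrable lborel (\<lambda>x. exp (- \<theta> * x) * f x)"

lemma laplace_add:
  assumes "laplace_integrable f \<theta>" "laplace_integrable g \<theta>"
  shows "laplace_integrable (\<lambda>x. f x + g x) \<theta>"
    and "laplace (\<lambda>x. f x + g x) \<theta> = laplace f \<theta> + laplace g \<theta>"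
  using assms unfolding laplace_def laplace_integrable_def
  by (simp_all add: distrib_left)

lemma laplace_cmult:
  assumes "laplace_integrable f \<theta>"
  shows "laplace_integrable (\<lambda>x. c * f x) \<theta>"
    and "laplace (\<lambda>x. c * f x) \<theta> = c * laplace f \<theta>"
proof -
  have eq: "(\<lambda>x. exp (- \<theta> * x) * (c * f x)) = (\<lambda>x. c * (exp (- \<theta> * x) * f x))"
    by (auto simp: mult_ac)
  show "laplace_integrable (\<lambda>x. c * f x) \<theta>" "laplace (\<lambda>x. c * f x) \<theta> = c * laplace f \<theta>"
    using assms unfolding laplace_def laplace_integrable_def eq by auto
qed

lemma laplace_conv:
  assumes [measurable]: "f \<in> borel_measurable borel" "g \<in> borel_measurable borel"
    and f: "laplace_integrable f \<theta>" and g: "laplace_integrable g \<theta>"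
  shows "laplace_integrable (conv f g) \<theta>" and "laplace (conv f g) \<theta> = laplace f \<theta> * laplace g \<theta>"
proof -
  define F where "F = (\<lambda>x. exp (- \<theta> * x) * f x)"
  define G where "G = (\<lambda>x. exp (- \<theta> * x) * g x)"
  define H where "H = (\<lambda>(y, x). F (x - y) * G y)"
  have [measurable]: "F \<in> borel_measurable borel" "G \<in> borel_measurable borel"
    unfolding F_def G_def by measurable
  have F: "integrable lborel F" and G: "integrable lborel G"
    using f g by (auto simp: F_def G_def laplace_integrable_def)
  have shift: "integrable lborel (\<lambda>x. u (x - y))" "(\<integral>x. u (x - y) \<partial>lborel) = (\<integral>x. u x \<partial>lborel)"
    if "integrable lborel u" for u :: "real \<Rightarrow> real" and y
    using lborel_integrable_real_affine[OF that, of 1 "-y"]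
      lborel_integral_real_affine[of 1 u "-y"] by (simp_all add: algebra_simps)
  have H: "integrable (lborel \<Otimes>\<^sub>M lborel) H"
  proof (rule lborel_pair.Fubini_integrable)
    show "H \<in> borel_measurable (lborel \<Otimes>\<^sub>M lborel)" unfolding H_def by measurable
    have "(\<integral>x. norm (H (y, x)) \<partial>lborel) = (\<integral>x. \<bar>F x\<bar> \<partial>lborel) * \<bar>G y\<bar>" for y
      using shift(2)[of "\<lambda>x. \<bar>F x\<bar>" y] F by (simp add: H_def abs_mult)
    then show "integrable lborel (\<lambda>y. \<integral>x. norm (H (y, x)) \<partial>lborel)" using G by simp
    show "AE y in lborel. integrable lborel (\<lambda>x. H (y, x))" using shift(1)[OF F] by (simp add: H_def)
  qed
  have eq: "exp (- \<theta> * x) * conv f g x = (\<integral>y. H (y, x) \<partial>lborel)" for x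
  proof -
    have "exp (- \<theta> * x) * (f (x - y) * g y) = H (y, x)" for y
      using exp_add[of "- \<theta> * (x - y)" "- \<theta> * y"] by (simp add: H_def F_def G_def algebra_simps)
    then show ?thesis unfolding conv_def by (simp flip: integral_mult_right_zero)
  qed
  have H': "integrable (lborel \<Otimes>\<^sub>M lborel) (\<lambda>(x, y). H (y, x))"
    using lborel_pair.integrable_product_swap[OF H] .
  show "laplace_integrable (conv f g) \<theta>"
    unfolding laplace_integrable_def eq using lborel_pair.integrable_fst'[OF H'] by simp
  have "laplace (conv f g) \<theta> = (\<integral>x. (\<integral>y. H (y, x) \<partial>lborel) \<partial>lborel)"
    unfolding laplace_def eq ..
  also have "\<dots> = (\<integral>y. (\<integral>x. H (y, x) \<partial>lborel) \<partial>lborel)"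
    using lborel_pair.Fubini_integral[of "\<lambda>y x. H (y, x)"] H by simp
  also have "\<dots> = (\<integral>y. (\<integral>x. F x \<partial>lborel) * G y \<partial>lborel)"
    using shift(2)[OF F] by (simp add: H_def)
  also have "\<dots> = laplace f \<theta> * laplace g \<theta>" by (simp add: laplace_def F_def G_def)
  finally show "laplace (conv f g) \<theta> = laplace f \<theta> * laplace g \<theta>" .
qed

lemma laplace_heaviside:
  assumes "0 < \<theta>"
  shows "laplace_integrable heaviside \<theta>" and "laplace heaviside \<theta> = 1 / \<theta>"
proof -
  have "has_bochner_integral lborel (\<lambda>x. x ^ 0 * exp (- x) * indicator {0<..} x :: real) (fact 0)"
    by (rule has_bochner_integral_I0i_power_exp_m)
  then have "has_bochner_integral lborel (\<lambda>x. exp (- x) * heaviside x) 1"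
    by (rule has_bochner_integral_cong[THEN iffD1, rotated 3]) (auto simp: heaviside_def indicator_def)
  then have "has_bochner_integral lborel (\<lambda>x. exp (- (0 + \<theta> * x)) * heaviside (0 + \<theta> * x)) (1 /\<^sub>R \<bar>\<theta>\<bar>)"
    using lborel_has_bochner_integral_real_affine_iff[of \<theta> "\<lambda>x. exp (- x) * heaviside x" 1 0] assms by simp
  then have "has_bochner_integral lborel (\<lambda>x. exp (- \<theta> * x) * heaviside x) (1 / \<theta>)"
    by (rule has_bochner_integral_cong[THEN iffD1, rotated 3])
      (use assms in \<open>auto simp: heaviside_def zero_less_mult_iff field_simps\<close>)
  then show "laplace_integrable heaviside \<theta>" "laplace heaviside \<theta> = 1 / \<theta>"
    by (auto simp: laplace_integrable_def laplace_def has_bochner_integral_iff)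
qed

text \<open>Lerch's theorem. After the factor \<open>exp (- (\<theta>\<^sub>0 + 1) x)\<close> has been absorbed into \<open>F\<close>, the hypothesis says that
\<open>F\<close> is orthogonal to all polynomials in \<open>exp (- x)\<close>, hence by the Weierstrass theorem to all continuous functions of
\<open>exp (- x)\<close>. Testing against \<open>F\<close> itself, multiplied by a bump function around a point where
\<open>f\<close> does not vanish, gives a contradiction.\<close>

lemma laplace_injective:
  assumes f: "\<And>\<theta>. \<theta> > \<theta>\<^sub>0 \<Longrightarrow> laplace_integrable f \<theta>" "\<And>\<theta>. \<theta> > \<theta>\<^sub>0 \<Longrightarrow> laplace f \<theta> = 0"
    and cont: "continuous_on {0<..} f" and nonpos: "\<And>x. x \<le> 0 \<Longrightarrow> f x = 0"
  shows "f = (\<lambda>x. 0)"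
proof (rule ccontr)
  assume "f \<noteq> (\<lambda>x. 0)"
  then obtain x\<^sub>0 where x0: "f x\<^sub>0 \<noteq> 0" "0 < x\<^sub>0" using nonpos by (metis linorder_not_le)
  define F where "F = (\<lambda>x. exp (- (\<theta>\<^sub>0 + 1) * x) * f x)"
  define bump where "bump = (\<lambda>x. max 0 ((x - x\<^sub>0 / 2) * (2 * x\<^sub>0 - x)))"
  define g where "g = (\<lambda>x. F x * bump x)"
  have F: "integrable lborel F" using f(1)[of "\<theta>\<^sub>0 + 1"] by (simp add: F_def laplace_integrable_def)
  have [measurable]: "F \<in> borel_measurable borel"
    using borel_measurable_integrable[OF F] by simp
  have bump_supp: "bump x = 0" if "x \<le> x\<^sub>0 / 2 \<or> 2 * x\<^sub>0 \<le> x" for x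
  proof -
    have "(x - x\<^sub>0 / 2) * (2 * x\<^sub>0 - x) \<le> 0" using that x0(2)
      by (auto simp: mult_le_0_iff)
    then show ?thesis by (simp add: bump_def)
  qed
  have cF: "continuous_on {0<..} F" unfolding F_def by (intro continuous_intros cont)
  have "isCont g x" for x
  proof (cases "0 < x")
    case True
    then have "isCont F x" using cF by (simp add: continuous_on_eq_continuous_at)
    then show ?thesis unfolding g_def bump_def by (intro continuous_intros)
  next
    case False
    have "continuous_on {..<x\<^sub>0/2} g"
      by (rule continuous_on_eq[of _ "\<lambda>_. 0"]) (use bump_supp in \<open>auto simp: g_def\<close>)
    then show ?thesis using False x0(2) by (simp add: continuous_on_eq_continuous_at)
  qed
  then have cg: "continuous_on UNIV g" by (simp add: continuous_on_eq_continuous_at)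
  \<comment> \<open>\<open>g\<close> as a function of \<open>t = exp (- x)\<close>; the bump makes it continuous at \<open>t = 0\<close>.\<close>
  define \<phi> where "\<phi> = (\<lambda>t. if 0 < t then g (- ln t) else 0)"
  have "continuous_on {0..1} \<phi>"
  proof (rule continuous_at_imp_continuous_on, rule ballI)
    fix t :: real assume "t \<in> {0..1}"
    show "isCont \<phi> t"
    proof (cases "0 < t")
      case True
      have "continuous_on {0<..} (\<lambda>t. g (- ln t))"
        by (rule continuous_on_compose2[OF cg]) (auto intro!: continuous_intros)
      then have "continuous_on {0<..} \<phi>" by (rule continuous_on_eq) (simp add: \<phi>_def)
      then show ?thesis using True by (simp add: continuous_on_eq_continuous_at)
    next
      case False
      have phi0: "\<phi> s = 0" if "s < exp (- (2 * x\<^sub>0))" for s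
      proof (cases "0 < s")
        case True
        have "ln s < ln (exp (- (2 * x\<^sub>0)))" using that True by (subst ln_less_cancel_iff) auto
        then show ?thesis using bump_supp[of "- ln s"] by (simp add: \<phi>_def g_def)
      qed (simp add: \<phi>_def)
      have "continuous_on {..<exp (- (2 * x\<^sub>0))} \<phi>"
        by (rule continuous_on_eq[of _ "\<lambda>_. 0"]) (simp_all add: phi0)
      moreover have "t < exp (- (2 * x\<^sub>0))" using False by (meson exp_gt_zero le_less_trans not_less)
      ultimately show ?thesis by (simp add: continuous_on_eq_continuous_at)
    qed
  qed
  have \<phi>: "\<phi> (exp (- x)) = g x" for x by (simp add: \<phi>_def)
  have Fg: "integrable lborel (\<lambda>x. F x * g x)"
  proof -
    have "compact (g ` {x\<^sub>0/2..2*x\<^sub>0})"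
      using cg by (intro compact_continuous_image) (auto intro: continuous_on_subset)
    then have "bounded (g ` {x\<^sub>0/2..2*x\<^sub>0})" by (rule compact_imp_bounded)
    then obtain B where B: "\<And>x. x \<in> {x\<^sub>0/2..2*x\<^sub>0} \<Longrightarrow> \<bar>g x\<bar> \<le> B"
      unfolding bounded_iff by (metis image_eqI real_norm_def)
    have B': "\<bar>g x\<bar> \<le> \<bar>B\<bar>" for x
    proof (cases "x \<in> {x\<^sub>0/2..2*x\<^sub>0}")
      case True then show ?thesis using B[OF True] by linarith
    next
      case False then show ?thesis using bump_supp[of x] by (auto simp: g_def)
    qed
    have "integrable lborel (\<lambda>x. \<bar>B\<bar> * F x)" using F by simp
    then show ?thesis
    proof (rule Bochner_Integration.integrable_bound)
      show "(\<lambda>x. F x * g x) \<in> borel_measurable lborel"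
        using borel_measurable_continuous_onI[OF cg] by measurable
      show "AE x in lborel. norm (F x * g x) \<le> norm (\<bar>B\<bar> * F x)"
        using B' by (auto simp: abs_mult mult.commute[of "\<bar>B\<bar>"] intro!: AE_I2 mult_left_mono)
    qed
  qed
  have poly: "integrable lborel (\<lambda>x. F x * p (exp (- x)))" "(\<integral>x. F x * p (exp (- x)) \<partial>lborel) = 0"
    if "real_polynomial_function p" "p = (\<lambda>x. \<Sum>i\<le>n. a i * x ^ i)" for p a n
  proof -
    have eq: "F x * p (exp (- x)) = (\<Sum>i\<le>n. a i * (exp (- (\<theta>\<^sub>0 + 1 + real i) * x) * f x))" for x
      unfolding that(2) F_def sum_distrib_left
    proof (rule sum.cong[OF refl])
      fix i
      have "exp (- (\<theta>\<^sub>0 + 1 + real i) * x) = exp (- (\<theta>\<^sub>0 + 1) * x) * exp (- x) ^ i"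
        by (simp add: exp_of_nat_mult [symmetric] exp_add [symmetric] algebra_simps)
      then show "exp (- (\<theta>\<^sub>0 + 1) * x) * f x * (a i * exp (- x) ^ i)
          = a i * (exp (- (\<theta>\<^sub>0 + 1 + real i) * x) * f x)" by (simp add: mult_ac)
    qed
    have i: "integrable lborel (\<lambda>x. exp (- (\<theta>\<^sub>0 + 1 + real i) * x) * f x)"
      "(\<integral>x. exp (- (\<theta>\<^sub>0 + 1 + real i) * x) * f x \<partial>lborel) = 0" for i
      using f(1)[of "\<theta>\<^sub>0 + 1 + real i"] f(2)[of "\<theta>\<^sub>0 + 1 + real i"]
      unfolding laplace_integrable_def laplace_def by auto
    show "integrable lborel (\<lambda>x. F x * p (exp (- x)))" "(\<integral>x. F x * p (exp (- x)) \<partial>lborel) = 0"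
      unfolding eq using i by (simp_all del: minus_add_distrib)
  qed
  have small: "\<bar>\<integral>x. F x * g x \<partial>lborel\<bar> \<le> e * (\<integral>x. \<bar>F x\<bar> \<partial>lborel)" if e: "0 < e" for e
  proof -
    obtain p where p: "real_polynomial_function p" "\<And>t. t \<in> {0..1} \<Longrightarrow> \<bar>\<phi> t - p t\<bar> < e"
      using Stone_Weierstrass_real_polynomial_function[OF compact_Icc \<open>continuous_on {0..1} \<phi>\<close> e] by blast
    obtain a n where an: "p = (\<lambda>x. \<Sum>i\<le>n. a i * x ^ i)"
      using p(1) real_polynomial_function_iff_sum by auto
    note P = poly[OF p(1) an]
    have "(\<integral>x. F x * g x \<partial>lborel) = (\<integral>x. F x * g x - F x * p (exp (- x)) \<partial>lborel)"
      using Fg P by simp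
    also have "\<bar>\<dots>\<bar> \<le> (\<integral>x. \<bar>F x * g x - F x * p (exp (- x))\<bar> \<partial>lborel)"
      using integral_norm_bound[of lborel "\<lambda>x. F x * g x - F x * p (exp (- x))"] by simp
    also have "\<dots> \<le> (\<integral>x. e * \<bar>F x\<bar> \<partial>lborel)"
    proof (intro integral_mono)
      fix x
      show "\<bar>F x * g x - F x * p (exp (- x))\<bar> \<le> e * \<bar>F x\<bar>"
      proof (cases "0 < x")
        case True
        have "\<bar>F x * g x - F x * p (exp (- x))\<bar> = \<bar>F x\<bar> * \<bar>\<phi> (exp (- x)) - p (exp (- x))\<bar>"
          by (simp add: \<phi> abs_mult [symmetric] algebra_simps)
        also have "\<dots> \<le> \<bar>F x\<bar> * e" using p(2)[of "exp (- x)"] True by (intro mult_left_mono) auto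
        finally show ?thesis by (simp add: mult.commute)
      qed (use nonpos[of x] in \<open>simp add: F_def\<close>)
    qed (use Fg P F in auto)
    finally show ?thesis by simp
  qed
  have "\<bar>\<integral>x. F x * g x \<partial>lborel\<bar> \<le> 0"
  proof (rule field_le_epsilon)
    fix e :: real assume e: "0 < e"
    let ?N = "\<integral>x. \<bar>F x\<bar> \<partial>lborel"
    have N: "0 \<le> ?N" by simp
    have "0 < e / (N + 1)" "e / (N + 1) * N \<le> e" if "0 \<le> N" for N
      using e that by (auto simp: field_simps)
    from this[OF N] show "\<bar>\<integral>x. F x * g x \<partial>lborel\<bar> \<le> 0 + e"
      using small[of "e / (?N + 1)"] by linarith
  qed
  moreover have nn: "0 \<le> F x * g x" for x
    unfolding g_def bump_def by (simp add: mult.assoc [symmetric] zero_le_mult_iff)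
  moreover have "0 \<le> (\<integral>x. F x * g x \<partial>lborel)" using nn by simp
  ultimately have "(\<integral>x. F x * g x \<partial>lborel) = 0" by linarith
  then have AE0: "AE x in lborel. F x * g x = 0"
    using integral_nonneg_eq_0_iff_AE[OF Fg] nn by simp
  define U where "U = {0<..} \<inter> (\<lambda>x. F x * g x) -` (- {0})"
  have U: "open U"
    unfolding U_def using cF cg
    by (intro continuous_open_preimage continuous_intros) (auto intro: continuous_on_subset)
  have "AE x in lborel. x \<notin> U" using AE0 by eventually_elim (simp add: U_def)
  then have "U \<in> null_sets lborel" using U by (subst AE_iff_null_sets) auto
  then have "negligible U" by (simp add: negligible_iff_null_sets null_sets_completionI)
  moreover have "x\<^sub>0 \<in> U"
    using x0 by (auto simp: U_def F_def g_def bump_def max_def)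
  ultimately show False using U open_not_negligible by blast
qed

section \<open>The double tail of a Levy measure\<close>

text \<open>For a jump \<open>x = - z\<close> this is \<open>(y - z)\<^sup>+ - y + z\<close> for a small and \<open>(y - z)\<^sup>+ - y\<close> for a large jump, that is,
\<open>(z - y)\<^sup>+\<close> and \<open>- min y z\<close>: the function whose second derivative is the point mass at \<open>z\<close> and
whose Laplace transform is the integrand of the Levy-Khintchine formula divided by \<open>\<theta>\<^sup>2\<close>.\<close>

definition levy_kernel :: "real \<Rightarrow> real \<Rightarrow> real" where
  "levy_kernel x y = (if x < 0 \<and> 0 < y then max (y + x) 0 - y - x * indicator {-1<..} x else 0)"

lemma levy_kernel_measurable [measurable]:
  "(\<lambda>(x, y). levy_kernel x y) \<in> borel_measurable (borel \<Otimes>\<^sub>M borel)"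
  unfolding levy_kernel_def[abs_def] by measurable

text \<open>The kernel decreases in \<open>y\<close> with slope \<open>-1\<close> before \<open>- x\<close> and slope 0 after it.\<close>

lemma levy_kernel_diff:
  assumes "x < 0" "0 < y" "y \<le> z"
  shows "(z - y) * indicator {..<-z} x \<le> levy_kernel x y - levy_kernel x z"
    and "levy_kernel x y - levy_kernel x z \<le> (z - y) * indicator {..<-y} x"
  using assms by (auto simp: levy_kernel_def indicator_def max_def)

lemma levy_kernel_laplace:
  assumes "0 < \<theta>" "x < 0"
  shows "laplace (levy_kernel x) \<theta> = (exp (\<theta> * x) - 1 - \<theta> * x * indicator {-1<..} x) / \<theta>\<^sup>2"
proof -
  let ?J = "conv heaviside heaviside"
  note H = laplace_heaviside[OF assms(1)]
  have [measurable]: "heaviside \<in> borel_measurable borel"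
    by (rule volterra_measurable[OF volterra_heaviside])
  have J: "laplace_integrable ?J \<theta>" "laplace ?J \<theta> = 1 / \<theta>\<^sup>2"
    using laplace_conv[OF _ _ H(1) H(1)] H(2) by (auto simp: power2_eq_square)
  have shift: "exp (- \<theta> * y) * ?J (y + x) = exp (\<theta> * x) * (exp (- \<theta> * (x + 1 * y)) * ?J (x + 1 * y))" for y
    by (simp add: algebra_simps flip: exp_add)
  have S: "laplace_integrable (\<lambda>y. ?J (y + x)) \<theta>" "laplace (\<lambda>y. ?J (y + x)) \<theta> = exp (\<theta> * x) / \<theta>\<^sup>2"
  proof -
    have "integrable lborel (\<lambda>y. exp (- \<theta> * (x + 1 * y)) * ?J (x + 1 * y))"
      using lborel_integrable_real_affine[OF J(1)[unfolded laplace_integrable_def], of 1 x] by simp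
    then show "laplace_integrable (\<lambda>y. ?J (y + x)) \<theta>"
      unfolding laplace_integrable_def shift by simp
    have "(\<integral>y. exp (- \<theta> * (x + 1 * y)) * ?J (x + 1 * y) \<partial>lborel) = 1 / \<theta>\<^sup>2"
      using lborel_integral_real_affine[of 1 "\<lambda>y. exp (- \<theta> * y) * ?J y" x] J(2)
      by (simp add: laplace_def)
    then show "laplace (\<lambda>y. ?J (y + x)) \<theta> = exp (\<theta> * x) / \<theta>\<^sup>2"
      unfolding laplace_def shift by simp
  qed
  have "levy_kernel x = (\<lambda>y. ?J (y + x) + ((-1) * ?J y + (- x * indicator {-1<..} x) * heaviside y))"
    using assms(2) by (auto simp: levy_kernel_def conv_heaviside_heaviside heaviside_def fun_eq_iff max_def)
  then have "laplace (levy_kernel x) \<theta>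
      = exp (\<theta> * x) / \<theta>\<^sup>2 + ((-1) * (1 / \<theta>\<^sup>2) + (- x * indicator {-1<..} x) * (1 / \<theta>))"
    by (simp only: S J H laplace_add laplace_cmult)
  also have "\<dots> = (exp (\<theta> * x) - 1 - \<theta> * x * indicator {-1<..} x) / \<theta>\<^sup>2"
    using assms(1) by (simp add: field_simps power2_eq_square)
  finally show ?thesis .
qed

text \<open>The Euler relation for a single jump: the derivative of \<open>t * levy_kernel x t\<close> is \<open>levy_kernel x t - t\<close>
up to \<open>t = - x\<close> and \<open>levy_kernel x t\<close> afterwards.\<close>

lemma levy_kernel_euler:
  assumes "x < 0"
  shows "y * levy_kernel x y = conv heaviside (\<lambda>t. levy_kernel x t - t * (indicator {..<-t} x * heaviside t)) y"
proof (cases "0 < y")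
  case False
  then have "heaviside (y - t) * (levy_kernel x t - t * (indicator {..<-t} x * heaviside t)) = 0" for t
    by (auto simp: heaviside_def levy_kernel_def)
  then have "conv heaviside (\<lambda>t. levy_kernel x t - t * (indicator {..<-t} x * heaviside t)) y = 0"
    unfolding conv_def by (simp only: integral_zero)
  then show ?thesis using False by (simp add: levy_kernel_def)
next
  case True
  let ?g = "\<lambda>t. levy_kernel x t - t * (indicator {..<-t} x * heaviside t)"
  let ?c = "- x * indicator {-1<..} x"
  \<comment> \<open>An explicit form of \<open>t * levy_kernel x t\<close> on \<open>t \<ge> 0\<close>.\<close>
  let ?G = "\<lambda>t. (if t \<le> - x then - (t\<^sup>2) else x * t) + ?c * t"
  have "(?g has_integral ?G y - ?G 0) {0..y}"
  proof (rule fundamental_theorem_of_calculus_interior_strong[of "{- x}"])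
    show "continuous_on {0..y} ?G"
    proof (intro continuous_intros)
      have "continuous_on ({..-x} \<union> {-x..}) (\<lambda>t. if t \<le> - x then - (t\<^sup>2) else x * t)"
        by (rule continuous_on_If) (auto intro!: continuous_intros simp: power2_eq_square)
      then show "continuous_on {0..y} (\<lambda>t. if t \<le> - x then - (t\<^sup>2) else x * t)"
        by (rule continuous_on_subset) auto
    qed
    fix t assume t: "t \<in> {0<..<y} - {- x}"
    have "(?G has_real_derivative ?g t) (at t)"
    proof (cases "t < - x")
      case True
      have "((\<lambda>t. - (t\<^sup>2) + ?c * t) has_real_derivative ?g t) (at t)"
        using True t assms
        by (auto intro!: derivative_eq_intros simp: levy_kernel_def heaviside_def max_def)
      then show ?thesis
        by (rule has_field_derivative_transform_within_open[of _ _ _ "{..<-x}"]) (use True in auto)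
    next
      case False
      have "((\<lambda>t. x * t + ?c * t) has_real_derivative ?g t) (at t)"
        using False t assms
        by (auto intro!: derivative_eq_intros simp: levy_kernel_def heaviside_def max_def)
      then show ?thesis
        by (rule has_field_derivative_transform_within_open[of _ _ _ "{-x<..}"]) (use False t in auto)
    qed
    then show "(?G has_vector_derivative ?g t) (at t)"
      unfolding has_real_derivative_iff_has_vector_derivative .
  next
    show "finite {- x}" by simp
    show "0 \<le> y" using True by simp
  qed
  moreover have "volterra ?g"
  proof (rule volterraI)
    show "power_dominated 1 ?g"
    proof (rule power_dominatedI)
      show "?g \<in> borel_measurable borel"
        unfolding levy_kernel_def[abs_def] heaviside_def[abs_def] indicator_def lessThan_iff
        by measurable
      fix T :: real assume "0 < T"
      have "\<bar>?g t\<bar> \<le> (2 * T + \<bar>x\<bar>) * power_kernel 1 t" if "0 < t" "t \<le> T" for t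
        using that by (auto simp: power_kernel_pos levy_kernel_def heaviside_def max_def indicator_def)
      then show "\<exists>C. \<forall>t. 0 < t \<and> t \<le> T \<longrightarrow> \<bar>?g t\<bar> \<le> C * power_kernel 1 t" by blast
    qed (auto simp: levy_kernel_def heaviside_def)
  qed simp
  ultimately have "conv heaviside ?g y = ?G y - ?G 0"
    by (simp add: conv_heaviside_eq_integral integral_unique)
  also have "\<dots> = y * levy_kernel x y"
    using assms True by (auto simp: levy_kernel_def max_def power2_eq_square algebra_simps)
  finally show ?thesis ..
qed

text \<open>A Blumenthal-Getoor index below 2 provides a moment of order \<open>\<beta> < 2\<close> near 0. Enlarging the order preserves
its finiteness, so \<open>\<beta> \<ge> 1\<close> is no restriction; this makes \<open>y powr (1 - \<beta>)\<close> decreasing.\<close>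

locale singular_levy_measure =
  fixes \<nu> :: "real measure" and \<beta> :: real
  assumes levy: "negative_levy_measure \<nu>"
    and \<beta>: "1 \<le> \<beta>" "\<beta> < 2"
    and moment: "integrable \<nu> (\<lambda>x. indicator {-1<..<0} x * \<bar>x\<bar> powr \<beta>)"
begin

lemma sets_eq [measurable_cong, simp]: "sets \<nu> = sets borel"
  using levy by (simp add: negative_levy_measure_def)

lemma space_eq [simp]: "space \<nu> = UNIV"
  using sets_eq_imp_space_eq[OF sets_eq] by simp

lemma emeasure_finite:
  assumes "0 < y" shows "emeasure \<nu> {..-y} < \<infinity>"
proof -
  have I: "(\<integral>\<^sup>+x\<in>{..<0}. ennreal (min 1 (x\<^sup>2)) \<partial>\<nu>) < \<infinity>"
    using levy by (simp add: negative_levy_measure_def)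
  have "ennreal (min 1 (y\<^sup>2)) * emeasure \<nu> {..-y} = (\<integral>\<^sup>+x. ennreal (min 1 (y\<^sup>2)) * indicator {..-y} x \<partial>\<nu>)"
    by (simp add: nn_integral_cmult_indicator)
  also have "\<dots> \<le> (\<integral>\<^sup>+x\<in>{..<0}. ennreal (min 1 (x\<^sup>2)) \<partial>\<nu>)"
  proof (intro nn_integral_mono)
    fix x
    have "min 1 (y\<^sup>2) \<le> min 1 (x\<^sup>2)" if "x \<le> - y"
      using that assms by (intro min.mono order_refl) (auto simp: power2_le_iff_abs_le abs_le_square_iff[symmetric])
    then show "ennreal (min 1 (y\<^sup>2)) * indicator {..-y} x \<le> ennreal (min 1 (x\<^sup>2)) * indicator {..<0} x"
      using assms by (auto simp: indicator_def intro!: ennreal_leI)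
  qed
  also have "\<dots> < \<infinity>" by (rule I)
  finally show ?thesis using assms
    by (auto simp: ennreal_mult_less_top ennreal_eq_0_iff min_def split: if_splits)
qed

lemma sigma_finite: "sigma_finite_measure \<nu>"
proof
  let ?A = "insert {0..} (range (\<lambda>n. {..- (1 / real (Suc n))}))"
  have "\<Union>?A = UNIV"
  proof (intro equalityI subsetI)
    fix x :: real
    show "x \<in> \<Union>?A"
    proof (cases "0 \<le> x")
      case False
      then obtain n where "1 / real (Suc n) < - x"
        using reals_Archimedean[of "- x"] by (auto simp: inverse_eq_divide)
      then have "x \<in> {..- (1 / real (Suc n))}" by simp
      then show ?thesis by blast
    qed simp
  qed simp
  then have union: "\<Union>?A = space \<nu>" by simp
  have finite0: "emeasure \<nu> {0..} \<noteq> \<infinity>" using levy by (simp add: negative_levy_measure_def)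
  have finiten: "emeasure \<nu> {..- (1 / real (Suc n))} \<noteq> \<infinity>" for n
    using emeasure_finite[of "1 / real (Suc n)"] by (simp add: less_top)
  show "\<exists>A. countable A \<and> A \<subseteq> sets \<nu> \<and> \<Union>A = space \<nu> \<and> (\<forall>a\<in>A. emeasure \<nu> a \<noteq> \<infinity>)"
  proof (intro exI[of _ ?A] conjI union)
    show "\<forall>a\<in>?A. emeasure \<nu> a \<noteq> \<infinity>"       by (intro ballI; elim insertE rangeE; simp only: finite0 finiten not_False_eq_True)
  qed (auto simp del: of_nat_Suc)
qed

lemma pair_sigma_finite: "pair_sigma_finite lborel \<nu>"
  by (intro pair_sigma_finite.intro sigma_finite lborel.sigma_finite_measure_axioms)

lemma AE_negative: "AE x in \<nu>. x < 0"
proof (rule AE_I')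
  show "{0..} \<in> null_sets \<nu>" using levy by (auto simp: negative_levy_measure_def null_sets_def)
qed auto

lemma integrable_indicator_tail:
  assumes "0 < y" "A \<in> sets borel" "A \<subseteq> {..-y}" shows "integrable \<nu> (indicat_real A)"
  using assms emeasure_mono[of A "{..-y}" \<nu>] emeasure_finite[OF assms(1)]
  by (simp add: integrable_indicator_iff)

text \<open>A common bound for the kernel and for \<open>y\<close> times the indicator of the jumps beyond \<open>y\<close>; the first
summand controls the small and the second one the large jumps.\<close>

definition dominator :: "real \<Rightarrow> real \<Rightarrow> real" where
  "dominator x y = indicator {-1<..<0} x * \<bar>x\<bar> powr \<beta> * power_kernel (2 - \<beta>) y
     + indicator {..-1} x * (y * heaviside y)"

definition small_moment :: real where
  "small_moment = (\<integral>x. indicator {-1<..<0} x * \<bar>x\<bar> powr \<beta> \<partial>\<nu>)"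

definition big_mass :: real where "big_mass = measure \<nu> {..-1}"

lemma small_moment_nonneg: "0 \<le> small_moment"
  unfolding small_moment_def by (intro integral_nonneg_AE) auto

lemma dominator_nonneg [simp]: "0 \<le> dominator x y"
  by (auto simp: dominator_def heaviside_def)

lemma dominator_integral:
  "has_bochner_integral \<nu> (\<lambda>x. dominator x y) (small_moment * power_kernel (2 - \<beta>) y + big_mass * (y * heaviside y))"
proof -
  have "has_bochner_integral \<nu> (indicat_real {..-1}) big_mass"
    using integrable_indicator_tail[of 1 "{..-1}"] by (simp add: has_bochner_integral_iff big_mass_def)
  moreover have "has_bochner_integral \<nu> (\<lambda>x. indicator {-1<..<0} x * \<bar>x\<bar> powr \<beta>) small_moment"
    using moment by (simp add: has_bochner_integral_iff small_moment_def)
  ultimately show ?thesis unfolding dominator_def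
    by (intro has_bochner_integral_add has_bochner_integral_mult_left)
qed

text \<open>A small jump that is longer than \<open>y\<close> satisfies \<open>z = z\<^sup>\<beta> z\<^sup>1\<^sup>-\<^sup>\<beta> \<le> z\<^sup>\<beta> y\<^sup>1\<^sup>-\<^sup>\<beta>\<close>.
This is where the index enters: the exponent \<open>1 - \<beta>\<close> exceeds \<open>-1\<close>, so the singularity of the double tail
is integrable with room to spare.\<close>

lemma power_split:
  assumes "x < 0" "y < - x" "0 < y"
  shows "- x \<le> \<bar>x\<bar> powr \<beta> * power_kernel (2 - \<beta>) y"
proof -
  have "- x = (- x) powr \<beta> * (- x) powr (1 - \<beta>)"
    using assms by (simp flip: powr_add)
  also have "\<dots> \<le> (- x) powr \<beta> * y powr (1 - \<beta>)"
    using assms \<beta> by (intro mult_left_mono powr_mono2') auto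
  finally show ?thesis using assms by (simp add: power_kernel_pos)
qed

lemma levy_kernel_bound: "\<bar>levy_kernel x y\<bar> \<le> dominator x y"
proof (cases "x < 0 \<and> 0 < y")
  case True
  show ?thesis
  proof (cases "-1 < x")
    case x: True
    show ?thesis
    proof (cases "y < - x")
      case True
      then show ?thesis using x \<open>x < 0 \<and> 0 < y\<close> power_split[of x y]
        by (auto simp: levy_kernel_def dominator_def max_def heaviside_def)
    next
      case False
      then have "levy_kernel x y = 0" using x by (auto simp: levy_kernel_def max_def)
      then show ?thesis by simp
    qed
  next
    case False
    then show ?thesis using True
      by (auto simp: levy_kernel_def dominator_def max_def heaviside_def)
  qed
qed (auto simp: levy_kernel_def dominator_def heaviside_def)

lemma tail_indicator_bound: "\<bar>y * (indicator {..<-y} x * heaviside y)\<bar> \<le> dominator x y"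
proof (cases "0 < y \<and> x < - y")
  case True
  then show ?thesis using power_split[of x y]
    by (cases "-1 < x") (auto simp: dominator_def heaviside_def)
qed (auto simp: dominator_def heaviside_def indicator_def)

text \<open>Up to a constant, the integral of the tail \<open>levy_tail \<nu>\<close> from \<open>y\<close> to 1. The integral of the kernel is
easier to handle than the iterated one.\<close>

definition double_tail :: "real \<Rightarrow> real" where
  "double_tail y = (\<integral>x. levy_kernel x y \<partial>\<nu>)"

definition tail_moment :: "real \<Rightarrow> real" where
  "tail_moment y = y * (levy_tail \<nu> y * heaviside y)"

lemma levy_kernel_integrable: "integrable \<nu> (\<lambda>x. levy_kernel x y)"
  using dominator_integral[of y, unfolded has_bochner_integral_iff, THEN conjunct1]
  by (rule Bochner_Integration.integrable_bound)
    (auto intro!: AE_I2 order_trans[OF levy_kernel_bound])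

lemma tail_moment_eq_integral: "tail_moment y = (\<integral>x. y * (indicator {..<-y} x * heaviside y) \<partial>\<nu>)"
  by (simp add: tail_moment_def levy_tail_def)

lemma tail_indicator_integrable: "integrable \<nu> (\<lambda>x. y * (indicator {..<-y} x * heaviside y))"
  using dominator_integral[of y, unfolded has_bochner_integral_iff, THEN conjunct1]
  by (rule Bochner_Integration.integrable_bound)
    (auto intro!: AE_I2 order_trans[OF tail_indicator_bound])

lemma power_dominated_integral:
  assumes [measurable]: "(\<lambda>(y, x). k x y) \<in> borel_measurable (borel \<Otimes>\<^sub>M borel)"
    and k: "\<And>x y. \<bar>k x y\<bar> \<le> dominator x y"
  shows "power_dominated (2 - \<beta>) (\<lambda>y. \<integral>x. k x y \<partial>\<nu>)"
proof (rule power_dominatedI)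
  interpret P: pair_sigma_finite lborel \<nu> by (rule pair_sigma_finite)
  show "(\<lambda>y. \<integral>x. k x y \<partial>\<nu>) \<in> borel_measurable borel" by measurable
next
  fix y :: real assume "y \<le> 0"
  then have "k x y = 0" for x using k[of x y] by (auto simp: dominator_def heaviside_def)
  then show "(\<integral>x. k x y \<partial>\<nu>) = 0" by simp
next
  fix T :: real assume T: "0 < T"
  have "\<bar>\<integral>x. k x y \<partial>\<nu>\<bar> \<le> (small_moment + big_mass * T powr \<beta>) * power_kernel (2 - \<beta>) y"
    if y: "0 < y" "y \<le> T" for y
  proof -
    have dom: "integrable \<nu> (\<lambda>x. dominator x y)"
      using dominator_integral[of y] by (simp add: has_bochner_integral_iff)
    have "(\<lambda>x. k x y) \<in> borel_measurable \<nu>" by measurable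
    then have int: "integrable \<nu> (\<lambda>x. k x y)"
      by (rule Bochner_Integration.integrable_bound[OF dom]) (use k in \<open>auto intro!: AE_I2\<close>)
    have "\<bar>\<integral>x. k x y \<partial>\<nu>\<bar> \<le> (\<integral>x. \<bar>k x y\<bar> \<partial>\<nu>)"
      using integral_norm_bound[of \<nu> "\<lambda>x. k x y"] by simp
    also have "\<dots> \<le> (\<integral>x. dominator x y \<partial>\<nu>)"
      using int dom k by (intro integral_mono) auto
    also have "\<dots> = small_moment * power_kernel (2 - \<beta>) y + big_mass * y"
      using dominator_integral[of y] y by (simp add: has_bochner_integral_iff heaviside_def)
    also have "big_mass * y \<le> big_mass * (T powr \<beta> * power_kernel (2 - \<beta>) y)"
      using power_kernel_weaken[of "2 - \<beta>" 2 y T] y T \<beta>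
      by (intro mult_left_mono) (auto simp: power_kernel_pos big_mass_def)
    finally show ?thesis by (simp add: algebra_simps)
  qed
  then show "\<exists>C. \<forall>y. 0 < y \<and> y \<le> T \<longrightarrow> \<bar>\<integral>x. k x y \<partial>\<nu>\<bar> \<le> C * power_kernel (2 - \<beta>) y" by blast
qed

lemma power_dominated_double_tail: "power_dominated (2 - \<beta>) double_tail"
  unfolding double_tail_def[abs_def]
  by (rule power_dominated_integral[OF _ levy_kernel_bound])
    (unfold levy_kernel_def[abs_def], measurable)

lemma power_dominated_tail_moment: "power_dominated (2 - \<beta>) tail_moment"
  unfolding tail_moment_eq_integral[abs_def]
  by (rule power_dominated_integral[OF _ tail_indicator_bound])
    (unfold heaviside_def[abs_def] indicator_def lessThan_iff, measurable)

text \<open>Bounds of the difference quotients of the double tail by the tail. They take the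
place of the formula \<open>double_tail' = - levy_tail \<nu>\<close>, which fails at the atoms of \<open>\<nu>\<close>.\<close>

lemma double_tail_diff:
  assumes "0 < y" "y \<le> z"
  shows "(z - y) * levy_tail \<nu> z \<le> double_tail y - double_tail z"
    and "double_tail y - double_tail z \<le> (z - y) * levy_tail \<nu> y"
proof -
  have eq: "double_tail y - double_tail z = (\<integral>x. levy_kernel x y - levy_kernel x z \<partial>\<nu>)"
    unfolding double_tail_def using levy_kernel_integrable by simp
  have tail: "integrable \<nu> (\<lambda>x. (z - y) * indicat_real {..<-w} x)"
    "(z - y) * levy_tail \<nu> w = (\<integral>x. (z - y) * indicator {..<-w} x \<partial>\<nu>)" if "0 < w" for w
  proof -
    have "{..<-w} \<subseteq> {..-w}" by auto
    then show "integrable \<nu> (\<lambda>x. (z - y) * indicat_real {..<-w} x)"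
      using integrable_indicator_tail[of w "{..<-w}"] that by simp
  qed (simp add: levy_tail_def)
  show "(z - y) * levy_tail \<nu> z \<le> double_tail y - double_tail z"
    unfolding eq tail(2)[OF less_le_trans[OF assms]]
    using tail(1)[of z] assms levy_kernel_integrable AE_negative
    by (intro integral_mono_AE) (auto elim!: eventually_mono intro: levy_kernel_diff)
  show "double_tail y - double_tail z \<le> (z - y) * levy_tail \<nu> y"
    unfolding eq tail(2)[OF assms(1)]
    using tail(1)[of y] assms levy_kernel_integrable AE_negative
    by (intro integral_mono_AE) (auto elim!: eventually_mono intro: levy_kernel_diff)
qed

lemma continuous_on_double_tail: "continuous_on {0<..} double_tail"
proof -
  have "isCont double_tail y" if "0 < y" for y
  proof -
    have "continuous_on {y/2<..} double_tail"
    proof (rule lipschitz_on_continuous_on[of "levy_tail \<nu> (y/2)"], rule lipschitz_onI)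
      have nn: "0 \<le> levy_tail \<nu> w" for w by (simp add: levy_tail_def)
      then show "0 \<le> levy_tail \<nu> (y/2)" .
      have mono: "levy_tail \<nu> w \<le> levy_tail \<nu> (y/2)" if "y/2 < w" for w
      proof -
        have "emeasure \<nu> {..<-(y/2)} \<le> emeasure \<nu> {..-(y/2)}" by (intro emeasure_mono) auto
        then have "emeasure \<nu> {..<-(y/2)} < \<infinity>"
          using emeasure_finite[of "y/2"] \<open>0 < y\<close> by (simp add: order.strict_trans1)
        then show ?thesis
          unfolding levy_tail_def measure_def
          using that by (intro enn2real_mono emeasure_mono) auto
      qed
      have *: "\<bar>double_tail u - double_tail v\<bar> \<le> levy_tail \<nu> (y/2) * \<bar>u - v\<bar>"
        if "y/2 < u" "u \<le> v" for u v
      proof -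
        have "0 < u" using that \<open>0 < y\<close> by simp
        note d = double_tail_diff[OF this that(2)]
        have "0 \<le> (v - u) * levy_tail \<nu> v" using nn that by simp
        moreover have "(v - u) * levy_tail \<nu> u \<le> (v - u) * levy_tail \<nu> (y/2)"
          using mono[OF that(1)] that by (intro mult_left_mono) auto
        ultimately show ?thesis using d that(2) by (simp add: mult.commute)
      qed
      fix u v assume "u \<in> {y/2<..}" "v \<in> {y/2<..}"
      then show "dist (double_tail u) (double_tail v) \<le> levy_tail \<nu> (y/2) * dist u v"
        using *[of u v] *[of v u] by (cases "u \<le> v") (auto simp: dist_real_def abs_minus_commute)
    qed
    then show ?thesis using that by (simp add: continuous_on_eq_continuous_at)
  qed
  then show ?thesis by (simp add: continuous_on_eq_continuous_at)
qed

text \<open>Where the tail is continuous, the two-sided bounds squeeze the difference quotients of the double tail. Conversely, where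
the double tail is differentiable, the upper bound for quotients to the right and the lower bound for
quotients to the left force the derivative to be minus the tail.\<close>

lemma C_on_double_tail_iff: "C_on (Suc n) {0<..} double_tail \<longleftrightarrow> C_on n {0<..} (levy_tail \<nu>)"
proof -
  let ?q = "\<lambda>y z. (double_tail z - double_tail y) / (z - y)"
  have right: "levy_tail \<nu> z \<le> - ?q y z \<and> - ?q y z \<le> levy_tail \<nu> y" if "0 < y" "y < z" for y z
    using double_tail_diff[of y z] that by (auto simp: field_simps)
  have left: "levy_tail \<nu> y \<le> - ?q y z \<and> - ?q y z \<le> levy_tail \<nu> z" if "0 < z" "z < y" for y z
    using double_tail_diff[of z y] that by (auto simp: field_simps)
  show ?thesis
  proof
    assume C: "C_on n {0<..} (levy_tail \<nu>)"
    have "(double_tail has_real_derivative - levy_tail \<nu> y) (at y)" if "0 < y" for y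
      unfolding has_field_derivative_iff
    proof (rule Lim_transform2[of "\<lambda>_. - levy_tail \<nu> y"])
      have "isCont (levy_tail \<nu>) y"
        using C_on_imp_continuous_on[OF C] that by (simp add: continuous_on_eq_continuous_at)
      then have lim: "((\<lambda>z. levy_tail \<nu> z - levy_tail \<nu> y) \<longlongrightarrow> 0) (at y)"
        by (simp add: isCont_def LIM_zero)
      show "((\<lambda>z. (- levy_tail \<nu> y) - ?q y z) \<longlongrightarrow> 0) (at y)"
      proof (rule Lim_null_comparison[OF _ tendsto_norm_zero[OF lim]])
        have "\<forall>\<^sub>F z in at y. 0 < z \<and> z \<noteq> y"
          using that by (auto intro!: eventually_conj eventually_neq_at_within
              order_tendstoD(1)[OF tendsto_ident_at])
        then show "\<forall>\<^sub>F z in at y. norm (- levy_tail \<nu> y - ?q y z) \<le> norm (levy_tail \<nu> z - levy_tail \<nu> y)"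
        proof eventually_elim
          case (elim z)
          then show ?case using left[of z y] right[of y z] that
            by (cases "z < y") auto
        qed
      qed
    qed simp
    then show "C_on (Suc n) {0<..} double_tail"
      using C_on_uminus[OF C] C_on_Suc_iff[of "{0<..}" double_tail "\<lambda>y. - levy_tail \<nu> y" n] by simp
  next
    assume "C_on (Suc n) {0<..} double_tail"
    then obtain f' where f': "\<And>y. 0 < y \<Longrightarrow> (double_tail has_real_derivative f' y) (at y)" "C_on n {0<..} f'"
      by auto
    have "- f' y = levy_tail \<nu> y" if "0 < y" for y
    proof (rule antisym)
      have lim: "((\<lambda>z. - ?q y z) \<longlongrightarrow> - f' y) (at y)"
        using f'(1)[OF that] unfolding has_field_derivative_iff by (intro tendsto_minus)
      have "((\<lambda>z. - ?q y z) \<longlongrightarrow> - f' y) (at_right y)"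
        using lim by (rule filterlim_mono) (auto simp: at_le)
      then show "- f' y \<le> levy_tail \<nu> y"
        by (rule tendsto_upperbound)
          (use right[OF that] in \<open>auto simp: eventually_at_right_field intro!: exI[of _ "y + 1"]\<close>)
      have "((\<lambda>z. - ?q y z) \<longlongrightarrow> - f' y) (at_left y)"
        using lim by (rule filterlim_mono) (auto simp: at_le)
      then show "levy_tail \<nu> y \<le> - f' y"
        by (rule tendsto_lowerbound)
          (use left that in \<open>auto simp: eventually_at_left_field intro!: exI[of _ 0]\<close>)
    qed
    then show "C_on n {0<..} (levy_tail \<nu>)"
      using C_on_cong[OF _ _ C_on_uminus[OF f'(2)], of "levy_tail \<nu>"] by simp
  qed
qed

text \<open>The Euler relation of the kernel integrated over all jumps; the tail moment \<open>y * levy_tail \<nu> y\<close> obeys the same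
bound as the double tail itself.\<close>

lemma double_tail_euler:
  "y * double_tail y = conv heaviside (\<lambda>t. double_tail t + (-1) * tail_moment t) y"
proof -
  interpret P: pair_sigma_finite lborel \<nu> by (rule pair_sigma_finite)
  define k where "k = (\<lambda>x t. levy_kernel x t - t * (indicator {..<-t} x * heaviside t))"
  define F where "F = (\<lambda>(t, x). heaviside (y - t) * k x t)"
  have k_int: "integrable \<nu> (\<lambda>x. k x t)" for t
    unfolding k_def using levy_kernel_integrable tail_indicator_integrable by simp
  have k_bound: "\<bar>k x t\<bar> \<le> 2 * dominator x t" for x t
    using levy_kernel_bound[of x t] tail_indicator_bound[of t x] unfolding k_def by linarith
  have F: "integrable (lborel \<Otimes>\<^sub>M \<nu>) F"
  proof (rule P.Fubini_integrable)
    show Fm [measurable]: "F \<in> borel_measurable (lborel \<Otimes>\<^sub>M \<nu>)"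
      unfolding F_def k_def levy_kernel_def[abs_def] heaviside_def[abs_def] indicator_def lessThan_iff
        greaterThan_iff by measurable
    let ?D = "\<lambda>t. heaviside (y - t) * (2 * (small_moment * power_kernel (2 - \<beta>) t + big_mass * (t * heaviside t)))"
    have vD: "volterra (\<lambda>t. 2 * (small_moment * power_kernel (2 - \<beta>) t + big_mass * (t * heaviside t)))"
    proof (intro volterra_cmult volterra_add volterra_times_id volterra_heaviside)
      show "volterra (power_kernel (2 - \<beta>))"
        using \<beta> by (intro volterraI[of "2 - \<beta>"]) (auto simp: power_dominated_def intro!: exI[of _ 1])
    qed
    have "integrable lborel ?D" by (rule volterra_conv_integrable[OF volterra_heaviside vD])
    then show "integrable lborel (\<lambda>t. \<integral>x. norm (F (t, x)) \<partial>\<nu>)"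
    proof (rule Bochner_Integration.integrable_bound)
      show "(\<lambda>t. \<integral>x. norm (F (t, x)) \<partial>\<nu>) \<in> borel_measurable lborel" by measurable
      have "(\<integral>x. norm (F (t, x)) \<partial>\<nu>) \<le> ?D t" for t
      proof -
        have "(\<integral>x. norm (F (t, x)) \<partial>\<nu>) \<le> (\<integral>x. heaviside (y - t) * (2 * dominator x t) \<partial>\<nu>)"
          using k_int dominator_integral[of t] k_bound
          by (intro integral_mono)
            (auto simp: F_def abs_mult heaviside_def has_bochner_integral_iff)
        also have "\<dots> = ?D t"
          using dominator_integral[of t] by (simp add: has_bochner_integral_iff)
        finally show ?thesis .
      qed
      then show "AE t in lborel. norm (\<integral>x. norm (F (t, x)) \<partial>\<nu>) \<le> norm (?D t)"
        by (intro AE_I2) (smt (verit) Bochner_Integration.integral_nonneg norm_ge_zero real_norm_def)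
    qed
    show "AE t in lborel. integrable \<nu> (\<lambda>x. F (t, x))"
      using k_int by (simp add: F_def)
  qed
  have "y * double_tail y = (\<integral>x. y * levy_kernel x y \<partial>\<nu>)" by (simp add: double_tail_def)
  also have "\<dots> = (\<integral>x. (\<integral>t. F (t, x) \<partial>lborel) \<partial>\<nu>)"
  proof (rule integral_cong_AE)
    show "(\<lambda>x. y * levy_kernel x y) \<in> borel_measurable \<nu>"
      using levy_kernel_integrable[of y] by (intro borel_measurable_times) auto
    show "(\<lambda>x. \<integral>t. F (t, x) \<partial>lborel) \<in> borel_measurable \<nu>"
      using P.integrable_snd[of "\<lambda>t x. F (t, x)"] F by (auto intro!: borel_measurable_integrable)
    show "AE x in \<nu>. y * levy_kernel x y = (\<integral>t. F (t, x) \<partial>lborel)"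
      using AE_negative by eventually_elim (simp add: levy_kernel_euler F_def k_def conv_def)
  qed
  also have "\<dots> = (\<integral>t. (\<integral>x. F (t, x) \<partial>\<nu>) \<partial>lborel)"
    using P.Fubini_integral[of "\<lambda>t x. F (t, x)"] F by simp
  also have "\<dots> = (\<integral>t. heaviside (y - t) * (double_tail t + (-1) * tail_moment t) \<partial>lborel)"
    using levy_kernel_integrable tail_indicator_integrable
    by (simp add: F_def k_def double_tail_def tail_moment_eq_integral)
  finally show ?thesis by (simp add: conv_def)
qed

text \<open>The jump part of the Laplace exponent is \<open>\<theta>\<^sup>2\<close> times the Laplace transform of the double tail: Fubini,
applied to the transform of the kernel.\<close>

lemma laplace_double_tail:
  assumes "0 < \<theta>"
  shows "laplace_integrable double_tail \<theta>"
    and "\<theta>\<^sup>2 * laplace double_tail \<theta>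
      = (LINT x:{..<0}|\<nu>. exp (\<theta> * x) - 1 - \<theta> * x * indicator {-1<..} x)"
proof -
  interpret P: pair_sigma_finite lborel \<nu> by (rule pair_sigma_finite)
  define F where "F = (\<lambda>(t, x). exp (- \<theta> * t) * levy_kernel x t)"
  have F: "integrable (lborel \<Otimes>\<^sub>M \<nu>) F"
  proof (rule P.Fubini_integrable)
    show Fm [measurable]: "F \<in> borel_measurable (lborel \<Otimes>\<^sub>M \<nu>)"
      unfolding F_def levy_kernel_def[abs_def] indicator_def greaterThan_iff by measurable
    let ?J = "conv heaviside heaviside"
    \<comment> \<open>The singularity matters only on \<open>(0, 1]\<close>; beyond 1 the power is at most 1.\<close>
    let ?D = "\<lambda>t. small_moment * (indicator {0..1} t * power_kernel (2 - \<beta>) t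
      + exp (- \<theta> * t) * heaviside t) + big_mass * (exp (- \<theta> * t) * ?J t)"
    have vP: "volterra (power_kernel (2 - \<beta>))"
      using \<beta> by (intro volterraI[of "2 - \<beta>"]) (auto simp: power_dominated_def intro!: exI[of _ 1])
    have Hm: "heaviside \<in> borel_measurable borel"
      by (rule volterra_measurable[OF volterra_heaviside])
    note H = laplace_heaviside(1)[OF assms]
    have "integrable lborel ?D"
      using volterra_set_integrable[OF vP, of 1] H laplace_conv(1)[OF Hm Hm H H]
      by (auto simp: set_integrable_def laplace_integrable_def)
    then show "integrable lborel (\<lambda>t. \<integral>x. norm (F (t, x)) \<partial>\<nu>)"
    proof (rule Bochner_Integration.integrable_bound)
      show "(\<lambda>t. \<integral>x. norm (F (t, x)) \<partial>\<nu>) \<in> borel_measurable lborel" by measurable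
      have "(\<integral>x. norm (F (t, x)) \<partial>\<nu>) \<le> ?D t" for t
      proof -
        have "(\<integral>x. norm (F (t, x)) \<partial>\<nu>) \<le> (\<integral>x. exp (- \<theta> * t) * dominator x t \<partial>\<nu>)"
          using levy_kernel_integrable dominator_integral[of t] levy_kernel_bound
          by (intro integral_mono) (auto simp: F_def abs_mult has_bochner_integral_iff)
        also have "\<dots> = small_moment * (exp (- \<theta> * t) * power_kernel (2 - \<beta>) t)
            + big_mass * (exp (- \<theta> * t) * ?J t)"
          using dominator_integral[of t]
          by (simp add: has_bochner_integral_iff conv_heaviside_heaviside algebra_simps)
        finally have *: "(\<integral>x. norm (F (t, x)) \<partial>\<nu>) \<le> small_moment * (exp (- \<theta> * t) * power_kernel (2 - \<beta>) t)
            + big_mass * (exp (- \<theta> * t) * ?J t)" .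
        have le: "exp (- \<theta> * t) * power_kernel (2 - \<beta>) t
            \<le> indicator {0..1} t * power_kernel (2 - \<beta>) t + exp (- \<theta> * t) * heaviside t"
        proof -
          consider "t \<le> 0" | "0 < t" "t \<le> 1" | "1 < t" by linarith
          then show ?thesis
          proof cases
            case 2
            then have "exp (- \<theta> * t) * power_kernel (2 - \<beta>) t \<le> 1 * power_kernel (2 - \<beta>) t"
              using assms by (intro mult_right_mono) auto
            then show ?thesis using 2 by (simp add: heaviside_def add_increasing2)
          next
            case 3
            then have "power_kernel (2 - \<beta>) t \<le> 1"
              using \<beta> powr_mono[of "1 - \<beta>" 0 t] by (simp add: power_kernel_pos)
            then show ?thesis using 3 by (simp add: heaviside_def)
          qed (simp add: heaviside_def)
        qed
        show ?thesis using * mult_left_mono[OF le small_moment_nonneg] by linarith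
      qed
      then show "AE t in lborel. norm (\<integral>x. norm (F (t, x)) \<partial>\<nu>) \<le> norm (?D t)"
        by (intro AE_I2) (smt (verit) Bochner_Integration.integral_nonneg norm_ge_zero real_norm_def)
    qed
    show "AE t in lborel. integrable \<nu> (\<lambda>x. F (t, x))"
      using levy_kernel_integrable by (simp add: F_def)
  qed
  have inner: "(\<integral>x. F (t, x) \<partial>\<nu>) = exp (- \<theta> * t) * double_tail t" for t
    by (simp add: F_def double_tail_def)
  show "laplace_integrable double_tail \<theta>"
    unfolding laplace_integrable_def inner [symmetric] using P.integrable_fst'[OF F] by simp
  have "laplace double_tail \<theta> = (\<integral>t. (\<integral>x. F (t, x) \<partial>\<nu>) \<partial>lborel)"
    by (simp add: laplace_def inner)
  also have "\<dots> = (\<integral>x. (\<integral>t. F (t, x) \<partial>lborel) \<partial>\<nu>)"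
    using P.Fubini_integral[of "\<lambda>t x. F (t, x)"] F by simp
  also have "\<dots> = (\<integral>x. indicator {..<0} x *\<^sub>R (exp (\<theta> * x) - 1 - \<theta> * x * indicator {-1<..} x) / \<theta>\<^sup>2 \<partial>\<nu>)"
  proof (rule integral_cong_AE)
    show "(\<lambda>x. \<integral>t. F (t, x) \<partial>lborel) \<in> borel_measurable \<nu>"
      using P.integrable_snd[of "\<lambda>t x. F (t, x)"] F by (auto intro!: borel_measurable_integrable)
    show "AE x in \<nu>. (\<integral>t. F (t, x) \<partial>lborel)
        = indicator {..<0} x *\<^sub>R (exp (\<theta> * x) - 1 - \<theta> * x * indicator {-1<..} x) / \<theta>\<^sup>2"
      using AE_negative
    proof eventually_elim
      case (elim x)
      then show ?case using levy_kernel_laplace[OF assms elim] by (simp add: F_def laplace_def)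
    qed
  qed measurable
  also have "\<dots> = (LINT x:{..<0}|\<nu>. exp (\<theta> * x) - 1 - \<theta> * x * indicator {-1<..} x) / \<theta>\<^sup>2"
    by (simp add: set_lebesgue_integral_def)
  finally show "\<theta>\<^sup>2 * laplace double_tail \<theta>
      = (LINT x:{..<0}|\<nu>. exp (\<theta> * x) - 1 - \<theta> * x * indicator {-1<..} x)"
    using assms by simp
qed

text \<open>The kernel is nonnegative for small jumps and at least \<open>- y\<close> for large ones.\<close>

lemma laplace_double_tail_lower:
  assumes "0 < \<theta>" shows "- big_mass \<le> \<theta>\<^sup>2 * laplace double_tail \<theta>"
proof -
  let ?J = "conv heaviside heaviside"
  have Hm: "heaviside \<in> borel_measurable borel"
    by (rule volterra_measurable[OF volterra_heaviside])
  note H = laplace_heaviside[OF assms]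
  note J = laplace_conv[OF Hm Hm H(1) H(1)]
  have lower: "- big_mass * ?J y \<le> double_tail y" for y
  proof -
    have "(\<integral>x. (- ?J y) * indicator {..-1} x \<partial>\<nu>) \<le> double_tail y"
      unfolding double_tail_def
    proof (rule integral_mono)
      show "integrable \<nu> (\<lambda>x. (- ?J y) * indicat_real {..-1} x)"
        using integrable_indicator_tail[of 1 "{..-1}"] by simp
      show "(- ?J y) * indicator {..-1} x \<le> levy_kernel x y" for x
        by (auto simp: conv_heaviside_heaviside heaviside_def levy_kernel_def indicator_def max_def)
    qed (rule levy_kernel_integrable)
    then show ?thesis by (simp add: big_mass_def mult.commute)
  qed
  have "laplace (\<lambda>y. - big_mass * ?J y) \<theta> \<le> laplace double_tail \<theta>"
    unfolding laplace_def
  proof (rule integral_mono)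
    show "exp (- \<theta> * y) * (- big_mass * ?J y) \<le> exp (- \<theta> * y) * double_tail y" for y
      using lower by (intro mult_left_mono) auto
  qed (use laplace_cmult(1)[OF J(1), of "- big_mass"] laplace_double_tail(1)[OF assms]
      in \<open>simp_all add: laplace_integrable_def\<close>)
  then have "- big_mass / \<theta>\<^sup>2 \<le> laplace double_tail \<theta>"
    using laplace_cmult(2)[OF J(1), of "- big_mass"] J(2) H(2) by (simp add: power2_eq_square)
  then show ?thesis using assms by (simp add: field_simps)
qed

end

section \<open>The Volterra equation of the scale function\<close>

text \<open>The order 2 always has a finite moment, so the infimum that defines the index is taken over a nonempty set, and some
order below 2 has a finite moment.\<close>

lemma obtain_singular_levy_measure:
  assumes "negative_levy_measure \<nu>" "blumenthal_getoor_index \<nu> < 2"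
  obtains \<beta> where "singular_levy_measure \<nu> \<beta>"
proof -
  define S where "S = {\<beta>. 0 \<le> \<beta> \<and> (\<integral>\<^sup>+x\<in>{x. \<bar>x\<bar> < 1}. ennreal (\<bar>x\<bar> powr \<beta>) \<partial>\<nu>) < \<infinity>}"
  have sets [measurable_cong, simp]: "sets \<nu> = sets borel"
    using assms(1) by (simp add: negative_levy_measure_def)
  have "{0..} \<in> null_sets \<nu>"
    using assms(1) by (auto simp: negative_levy_measure_def null_sets_def)
  then have neg: "AE x in \<nu>. x < 0" by (rule AE_I') auto
  have "(\<integral>\<^sup>+x\<in>{x. \<bar>x\<bar> < 1}. ennreal (\<bar>x\<bar> powr 2) \<partial>\<nu>)
      \<le> (\<integral>\<^sup>+x\<in>{..<0}. ennreal (min 1 (x\<^sup>2)) \<partial>\<nu>)"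
    using neg
  proof (intro nn_integral_mono_AE, eventually_elim)
    case (elim x)
    then show ?case by (auto simp: indicator_def abs_square_less_1 less_imp_le intro!: ennreal_leI)
  qed
  also have "\<dots> < \<infinity>" using assms(1) by (simp add: negative_levy_measure_def)
  finally have "S \<noteq> {}" unfolding S_def by (auto intro!: exI[of _ 2])
  moreover have "bdd_below S" unfolding S_def by (auto simp: bdd_below_def)
  ultimately obtain \<gamma> where \<gamma>: "\<gamma> \<in> S" "\<gamma> < 2"
    using assms(2) cInf_less_iff[of S 2] unfolding blumenthal_getoor_index_def S_def by blast
  define \<beta> where "\<beta> = max 1 \<gamma>"
  have "integrable \<nu> (\<lambda>x. indicator {-1<..<0} x * \<bar>x\<bar> powr \<beta>)"
  proof (rule integrableI_bounded)
    have "(\<integral>\<^sup>+x. ennreal (norm (indicator {-1<..<0} x * \<bar>x\<bar> powr \<beta>)) \<partial>\<nu>)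
        \<le> (\<integral>\<^sup>+x\<in>{x. \<bar>x\<bar> < 1}. ennreal (\<bar>x\<bar> powr \<gamma>) \<partial>\<nu>)"
    proof (intro nn_integral_mono)
      fix x :: real
      have "\<bar>x\<bar> powr \<beta> \<le> \<bar>x\<bar> powr \<gamma>" if "\<bar>x\<bar> < 1" "x \<noteq> 0"
        using that by (intro powr_mono') (auto simp: \<beta>_def)
      then show "ennreal (norm (indicator {-1<..<0} x * \<bar>x\<bar> powr \<beta>))
          \<le> ennreal (\<bar>x\<bar> powr \<gamma>) * indicator {x. \<bar>x\<bar> < 1} x"
        by (auto simp: indicator_def intro!: ennreal_leI)
    qed
    also have "\<dots> < \<infinity>" using \<gamma>(1) by (simp add: S_def)
    finally show "(\<integral>\<^sup>+x. ennreal (norm (indicator {-1<..<0} x * \<bar>x\<bar> powr \<beta>)) \<partial>\<nu>) < \<infinity>" .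
  qed measurable
  then have "singular_levy_measure \<nu> \<beta>"
    using assms(1) \<gamma>(2) by unfold_locales (auto simp: \<beta>_def)
  then show ?thesis by (rule that)
qed

context singular_levy_measure
begin

text \<open>The function whose Laplace transform is \<open>(\<psi> \<theta> - q) / \<theta>\<^sup>2 - \<sigma>\<^sup>2 / 2\<close>.\<close>

definition volterra_kernel :: "real \<Rightarrow> real \<Rightarrow> real \<Rightarrow> real" where
  "volterra_kernel a q y = double_tail y + (a * heaviside y + (-q) * conv heaviside heaviside y)"

lemma power_dominated_heaviside': "power_dominated (2 - \<beta>) heaviside"
  using power_dominated_weaken[OF power_dominated_heaviside] \<beta> by simp

lemma power_dominated_conv_heaviside: "power_dominated (2 - \<beta>) (conv heaviside heaviside)"
  using power_dominated_weaken[OF power_dominated_conv[OF power_dominated_heaviside power_dominated_heaviside]]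
    \<beta> by simp

lemma power_dominated_volterra_kernel: "power_dominated (2 - \<beta>) (volterra_kernel a q)"
  unfolding volterra_kernel_def[abs_def]
  by (intro power_dominated_add power_dominated_cmult power_dominated_double_tail
      power_dominated_heaviside' power_dominated_conv_heaviside)

lemma volterra_kernel_euler:
  "\<exists>g. power_dominated (2 - \<beta>) g \<and> (\<forall>y. y * volterra_kernel a q y = conv heaviside g y)"
proof (intro exI conjI allI)
  let ?H = heaviside and ?J = "conv heaviside heaviside"
  let ?g = "\<lambda>y. (double_tail y + (-1) * tail_moment y) + (a * ?H y + (-2 * q) * ?J y)"
  have pd: "power_dominated (2 - \<beta>) (\<lambda>y. double_tail y + (-1) * tail_moment y)"
    by (intro power_dominated_add power_dominated_cmult power_dominated_double_tail
        power_dominated_tail_moment)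
  show "power_dominated (2 - \<beta>) ?g"
    by (intro power_dominated_add power_dominated_cmult pd
        power_dominated_heaviside' power_dominated_conv_heaviside)
  fix y
  have b: "0 < 2 - \<beta>" using \<beta> by simp
  note vH = volterra_heaviside
  note vJ = volterra_conv[OF vH vH]
  have xH: "(\<lambda>x. x * ?H x) = ?J" using conv_heaviside_heaviside by auto
  have yJ: "y * ?J y = 2 * conv ?H ?J y"
    using conv_times_id[OF vH vH, of y]
      conv_commute[of ?J ?H] unfolding xH by simp
  have "conv ?H ?g y = conv ?H (\<lambda>y. double_tail y + (-1) * tail_moment y) y
      + (a * ?J y + (-2 * q) * conv ?H ?J y)"
    using volterraI[OF pd b] vH vJ
    by (simp only: conv_add_right conv_cmult_right volterra_add volterra_cmult)
  then show "y * volterra_kernel a q y = conv ?H ?g y"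
    unfolding double_tail_euler[symmetric] volterra_kernel_def
    using yJ conv_heaviside_heaviside[of y] by (simp add: algebra_simps)
qed

lemma C_on_volterra_kernel_iff:
  assumes "c \<noteq> 0"
  shows "C_on (Suc n) {0<..} (\<lambda>y. c * volterra_kernel a q y) \<longleftrightarrow> C_on n {0<..} (levy_tail \<nu>)"
proof -
  let ?p = "\<lambda>y. a + (-q) * y"
  have p: "C_on (Suc n) {0<..} ?p" by (intro C_on_add C_on_const C_on_cmult C_on_id)
  have eq: "volterra_kernel a q y = double_tail y + ?p y" if "0 < y" for y
    using that by (simp add: volterra_kernel_def conv_heaviside_heaviside heaviside_def)
  have "C_on (Suc n) {0<..} (volterra_kernel a q) \<longleftrightarrow> C_on (Suc n) {0<..} double_tail"
  proof
    assume "C_on (Suc n) {0<..} (volterra_kernel a q)"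
    from C_on_add[OF this C_on_uminus[OF p]] show "C_on (Suc n) {0<..} double_tail"
      by (rule C_on_cong[rotated 2]) (auto simp: eq)
  next
    assume "C_on (Suc n) {0<..} double_tail"
    from C_on_add[OF this p] show "C_on (Suc n) {0<..} (volterra_kernel a q)"
      by (rule C_on_cong[rotated 2]) (auto simp: eq)
  qed
  then show ?thesis using C_on_cmult_iff[OF assms] C_on_double_tail_iff by blast
qed

lemma continuous_on_volterra_kernel: "continuous_on {0<..} (volterra_kernel a q)"
proof -
  have "continuous_on {0<..} (\<lambda>y. double_tail y + (a + (-q) * y))"
    by (intro continuous_intros continuous_on_double_tail)
  then show ?thesis
    by (rule continuous_on_eq) (simp add: volterra_kernel_def conv_heaviside_heaviside heaviside_def)
qed

lemma laplace_volterra_kernel: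
  assumes "0 < \<theta>"
  shows "laplace_integrable (volterra_kernel a q) \<theta>"
    and "laplace (volterra_kernel a q) \<theta> = laplace double_tail \<theta> + (a / \<theta> - q / \<theta>\<^sup>2)"
proof -
  have Hm: "heaviside \<in> borel_measurable borel"
    by (rule volterra_measurable[OF volterra_heaviside])
  note H = laplace_heaviside[OF assms]
  note J = laplace_conv[OF Hm Hm H(1) H(1)]
  note ints = laplace_double_tail(1)[OF assms] H(1) J(1)
  show "laplace_integrable (volterra_kernel a q) \<theta>"
    unfolding volterra_kernel_def[abs_def] by (intro laplace_add laplace_cmult ints)
  show "laplace (volterra_kernel a q) \<theta> = laplace double_tail \<theta> + (a / \<theta> - q / \<theta>\<^sup>2)"
    unfolding volterra_kernel_def[abs_def] using ints
    by (simp only: laplace_add laplace_cmult J H) (simp add: power2_eq_square)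
qed

lemma laplace_exponent_eq:
  assumes "is_levy_triplet \<psi> a \<sigma> \<nu>" "0 < \<theta>"
  shows "\<psi> \<theta> = a * \<theta> + 1/2 * \<sigma>\<^sup>2 * \<theta>\<^sup>2 + \<theta>\<^sup>2 * laplace double_tail \<theta>"
  using assms laplace_double_tail(2)[OF assms(2)]
  by (simp add: is_levy_triplet_def levy_khintchine_exponent_def)

text \<open>The Gaussian term dominates the drift and the negative part of the jump term. The defining relation of
the scale function can therefore be multiplied by \<open>\<psi> \<theta> - q\<close> for all large \<open>\<theta>\<close>.\<close>

lemma laplace_exponent_exceeds:
  assumes "is_levy_triplet \<psi> a \<sigma> \<nu>" "0 < \<sigma>"
  obtains \<theta>\<^sub>1 where "0 < \<theta>\<^sub>1" "\<And>\<theta>. \<theta> > \<theta>\<^sub>1 \<Longrightarrow> q < \<psi> \<theta>"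
proof -
  define c where "c = 1/2 * \<sigma>\<^sup>2"
  define B where "B = \<bar>a\<bar> + big_mass + \<bar>q\<bar>"
  have c: "0 < c" using assms(2) by (simp add: c_def)
  have B: "0 \<le> big_mass" by (simp add: big_mass_def)
  \<comment> \<open>For \<open>\<theta> > 1\<close> the drift, the bound on the negative part of the jump term and \<open>q\<close> add up to at most \<open>B * \<theta>\<close>.\<close>
  have "q < \<psi> \<theta>" if "\<theta> > max 1 (B / c)" for \<theta>
  proof -
    have t: "1 < \<theta>" "B < c * \<theta>" using that c by (auto simp: field_simps)
    have "a * \<theta> + c * \<theta>\<^sup>2 - big_mass \<le> \<psi> \<theta>"
      using laplace_exponent_eq[OF assms(1), of \<theta>] laplace_double_tail_lower[of \<theta>] t(1)
      by (simp add: c_def)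
    moreover have "B * \<theta> < c * \<theta>\<^sup>2"
      using mult_strict_right_mono[OF t(2), of \<theta>] t(1) by (simp add: power2_eq_square mult.assoc)
    moreover have "- (\<bar>a\<bar> * \<theta>) \<le> a * \<theta>"
      using t(1) mult_right_mono[of "- \<bar>a\<bar>" a \<theta>] by simp
    moreover have "big_mass \<le> big_mass * \<theta>" "\<bar>q\<bar> \<le> \<bar>q\<bar> * \<theta>"
      using t(1) B mult_left_mono[of 1 \<theta> big_mass] mult_left_mono[of 1 \<theta> "\<bar>q\<bar>"] by auto
    ultimately show ?thesis by (simp add: B_def distrib_right)
  qed
  then show ?thesis using that[of "max 1 (B / c)"] by auto
qed

text \<open>The transform of \<open>W\<close> is \<open>1 / (\<psi> \<theta> - q)\<close>. Divided by \<open>\<theta>\<^sup>2\<close>, this relation involves only transforms of functions, and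
by the injectivity of the Laplace transform it becomes a Volterra equation of the second kind. The
assumption \<open>\<sigma> > 0\<close> is what makes it of the second kind.\<close>

lemma scale_function_volterra:
  assumes triplet: "is_levy_triplet \<psi> a \<sigma> \<nu>" and \<sigma>: "0 < \<sigma>"
    and scale: "is_scale_function \<psi> q W"
  defines "w \<equiv> \<lambda>x. W x * heaviside x"
  shows "power_dominated 1 w" and "continuous_on {0<..} w"
    and "(\<lambda>x. 1/2 * \<sigma>\<^sup>2 * w x + conv (volterra_kernel a q) w x) = conv heaviside heaviside"
proof -
  have contW: "continuous_on {0..} W" using scale by (simp add: is_scale_function_def)
  show cw: "continuous_on {0<..} w"
    by (rule continuous_on_eq[OF continuous_on_subset[OF contW]]) (auto simp: w_def heaviside_def)
  show pw: "power_dominated 1 w"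
  proof (rule power_dominated_1I[OF cw])
    fix T :: real assume "0 < T"
    have "compact (W ` {0..T})"
      by (intro compact_continuous_image continuous_on_subset[OF contW]) auto
    then have "bounded (W ` {0..T})" by (rule compact_imp_bounded)
    moreover have "w ` {0<..T} \<subseteq> W ` {0..T}" by (auto simp: w_def heaviside_def)
    ultimately show "bounded (w ` {0<..T})" by (rule bounded_subset)
  qed (simp add: w_def heaviside_def)
  let ?k = "volterra_kernel a q" and ?J = "conv heaviside heaviside" and ?c = "1/2 * \<sigma>\<^sup>2"
  have vk: "volterra ?k"
    using volterraI[OF power_dominated_volterra_kernel] \<beta> by simp
  have vw: "volterra w" using volterraI[OF pw] by simp
  have vJ: "volterra ?J" by (intro volterra_conv volterra_heaviside)
  have Hm: "heaviside \<in> borel_measurable borel"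
    by (rule volterra_measurable[OF volterra_heaviside])
  obtain \<theta>\<^sub>1 where t1: "0 < \<theta>\<^sub>1" "\<And>\<theta>. \<theta> > \<theta>\<^sub>1 \<Longrightarrow> q < \<psi> \<theta>"
    using laplace_exponent_exceeds[OF triplet \<sigma>] by blast
  define \<theta>\<^sub>0 where "\<theta>\<^sub>0 = max \<theta>\<^sub>1 (largest_root \<psi> q)"
  let ?d = "\<lambda>x. (?c * w x + conv ?k w x) + (-1) * ?J x"
  have lw: "laplace_integrable w \<theta>" "laplace w \<theta> = 1 / (\<psi> \<theta> - q)" if "\<theta> > \<theta>\<^sub>0" for \<theta>
  proof -
    have W: "set_integrable lborel {0..} (\<lambda>x. exp (- \<theta> * x) * W x)"
      "(LBINT x:{0..}. exp (- \<theta> * x) * W x) = 1 / (\<psi> \<theta> - q)"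
      using scale that by (auto simp: is_scale_function_def \<theta>\<^sub>0_def)
    have [measurable]: "w \<in> borel_measurable borel" by (rule volterra_measurable[OF vw])
    have AE: "AE x in lborel. indicator {0..} x *\<^sub>R (exp (- \<theta> * x) * W x) = exp (- \<theta> * x) * w x"
      using AE_lborel_singleton[of 0]
      by eventually_elim (auto simp: w_def heaviside_def indicator_def)
    note W' = W[unfolded set_integrable_def set_lebesgue_integral_def]
    have m: "(\<lambda>x. exp (- \<theta> * x) * w x) \<in> borel_measurable lborel" by measurable
    show "laplace_integrable w \<theta>"
      unfolding laplace_integrable_def
      using integrable_cong_AE[OF borel_measurable_integrable[OF W'(1)] m AE] W'(1) by simp
    show "laplace w \<theta> = 1 / (\<psi> \<theta> - q)"
      unfolding laplace_def
      using integral_cong_AE[OF borel_measurable_integrable[OF W'(1)] m AE] W'(2) by simp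
  qed
  have "?d = (\<lambda>x. 0)"
  proof (rule laplace_injective[of \<theta>\<^sub>0])
    fix \<theta> assume t: "\<theta> > \<theta>\<^sub>0"
    then have t0: "0 < \<theta>" "q < \<psi> \<theta>" using t1 by (auto simp: \<theta>\<^sub>0_def)
    note H = laplace_heaviside[OF t0(1)]
    note J = laplace_conv[OF Hm Hm H(1) H(1)]
    note K = laplace_volterra_kernel[OF t0(1), of a q]
    note kw = laplace_conv[OF volterra_measurable[OF vk] volterra_measurable[OF vw] K(1) lw(1)[OF t]]
    note ints = lw(1)[OF t] kw(1) J(1)
    show "laplace_integrable ?d \<theta>" by (intro laplace_add laplace_cmult ints)
    have "laplace ?d \<theta> = (?c * laplace w \<theta> + laplace ?k \<theta> * laplace w \<theta>) + (-1) * (1 / \<theta>\<^sup>2)"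
      using ints by (simp only: laplace_add laplace_cmult kw(2) J(2) H(2))
        (simp add: power2_eq_square)
    also have "\<dots> = (?c + a / \<theta> - q / \<theta>\<^sup>2 + laplace double_tail \<theta>) * laplace w \<theta> - 1 / \<theta>\<^sup>2"
      unfolding K(2) by (simp add: algebra_simps)
    also have "?c + a / \<theta> - q / \<theta>\<^sup>2 + laplace double_tail \<theta> = (\<psi> \<theta> - q) / \<theta>\<^sup>2"
      using laplace_exponent_eq[OF triplet t0(1)] t0(1) by (simp add: field_simps power2_eq_square)
    also have "(\<psi> \<theta> - q) / \<theta>\<^sup>2 * laplace w \<theta> - 1 / \<theta>\<^sup>2 = 0"
      using lw(2)[OF t] t0 by simp
    finally show "laplace ?d \<theta> = 0" .
  next
    have "continuous_on {0<..} (conv w ?k)"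
      using continuous_on_conv_bounded[OF pw cw vk] by (rule continuous_on_subset) simp
    moreover have "continuous_on {0<..} ?J"
      by (rule continuous_on_eq[of _ "\<lambda>x. x"]) (auto simp: conv_heaviside_heaviside heaviside_def)
    ultimately show "continuous_on {0<..} ?d"
      using cw by (simp only: conv_commute[of ?k w]) (intro continuous_intros)
  next
    show "?d x = 0" if "x \<le> 0" for x
      using that volterra_nonpos[OF vw] volterra_nonpos[OF volterra_conv[OF vk vw]]
        volterra_nonpos[OF vJ] by simp
  qed
  then have d: "?d x = 0" for x by (rule fun_cong)
  show "(\<lambda>x. ?c * w x + conv ?k w x) = ?J"
  proof
    fix x show "?c * w x + conv ?k w x = ?J x" using d[of x] by simp
  qed
qed

lemma C_on_scale_function_iff:
  assumes triplet: "is_levy_triplet \<psi> a \<sigma> \<nu>" and \<sigma>: "0 < \<sigma>"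
    and scale: "is_scale_function \<psi> q W"
  shows "C_on (n + 3) {0<..} W \<longleftrightarrow> C_on n {0<..} (levy_tail \<nu>)"
proof -
  define c where "c = 1/2 * \<sigma>\<^sup>2"
  have c: "0 < c" using \<sigma> by (simp add: c_def)
  define w where "w = (\<lambda>x. c * (W x * heaviside x))"
  define h where "h = (\<lambda>x. (1 / c) * volterra_kernel a q x)"
  note V = scale_function_volterra[OF triplet \<sigma> scale]
  have h: "power_dominated (2 - \<beta>) h"
    unfolding h_def by (intro power_dominated_cmult power_dominated_volterra_kernel)
  have b: "0 < 2 - \<beta>" using \<beta> by simp
  note vh = volterraI[OF h b]
  have ch: "continuous_on {0<..} h"
    unfolding h_def by (intro continuous_intros continuous_on_volterra_kernel)
  have vw: "volterra w" unfolding w_def by (intro volterra_cmult volterraI[OF V(1)]) simp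
  obtain g where g: "power_dominated (2 - \<beta>) g"
    "\<And>y. y * volterra_kernel a q y = conv heaviside g y"
    using volterra_kernel_euler by blast
  have "y * h y = conv heaviside (\<lambda>y. (1 / c) * g y) y" for y
    using g(2)[of y] unfolding h_def conv_cmult_right by simp
  then have sm: "eventually_smoothing h"
    by (rule eventually_smoothingI[OF h power_dominated_cmult[OF g(1)] b])
  have eq: "w = (\<lambda>x. conv heaviside heaviside x - conv h w x)"
  proof
    fix x
    have "conv h w x = conv (volterra_kernel a q) (\<lambda>x. W x * heaviside x) x"
      unfolding h_def w_def conv_cmult_left conv_cmult_right using c by simp
    then show "w x = conv heaviside heaviside x - conv h w x"
      using fun_cong[OF V(3), of x] by (simp add: w_def c_def)
  qed
  have "C_on (n + 3) {0<..} W \<longleftrightarrow> C_on (n + 3) {0<..} (\<lambda>x. W x * heaviside x)"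
    using C_on_cong[of "{0<..}" W "\<lambda>x. W x * heaviside x"]
      C_on_cong[of "{0<..}" "\<lambda>x. W x * heaviside x" W] by (auto simp: heaviside_def)
  also have "\<dots> \<longleftrightarrow> C_on (Suc n + 2) {0<..} w"
    using C_on_cmult_iff[of c "n + 3" "{0<..}" "\<lambda>x. W x * heaviside x"] c
    by (simp add: w_def numeral_3_eq_3 del: C_on.simps)
  also have "\<dots> \<longleftrightarrow> C_on (Suc n) {0<..} h"
    by (rule C_on_volterra_solution_iff[OF vh ch sm vw eq])
  also have "\<dots> \<longleftrightarrow> C_on n {0<..} (levy_tail \<nu>)"
    unfolding h_def using c by (intro C_on_volterra_kernel_iff) simp
  finally show ?thesis .
qed

end

theorem theorem2:
  fixes M :: "'a measure" and X :: "real \<Rightarrow> 'a \<Rightarrow> real"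
    and \<psi> :: "real \<Rightarrow> real" and a \<sigma> :: real and \<nu> :: "real measure"
    and q :: real and W :: "real \<Rightarrow> real" and n :: nat
  assumes "spectrally_negative_levy_process M X"
    and "is_laplace_exponent M X \<psi>"
    and "is_levy_triplet \<psi> a \<sigma> \<nu>"
    and "\<sigma> > 0"
    and "blumenthal_getoor_index \<nu> \<in> {0..<2}"
    and "q \<ge> 0"
    and "is_scale_function \<psi> q W"
  shows "C_on (n + 3) {0<..} W \<longleftrightarrow> C_on n {0<..} (levy_tail \<nu>)"
proof -
  have "negative_levy_measure \<nu>" using assms(3) by (simp add: is_levy_triplet_def)
  then obtain \<beta> where "singular_levy_measure \<nu> \<beta>"
    using obtain_singular_levy_measure assms(5) by auto
  then interpret singular_levy_measure \<nu> \<beta> .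
  show ?thesis by (rule C_on_scale_function_iff[OF assms(3,4,7)])
qed

end
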